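(* Let $N\ge2$, $b>0$, $0<\varepsilon<\pi/2$, $\lambda_0>0$, $\delta_0>0$ and let $\mu_\pm,\nu_+,\gamma_{1\pm},\gamma_{2+}>0$ be constants. Let $\det\mathbf L=L_{11}L_{22}-L_{12}L_{21}$ be the Lopatinski determinant defined in the context, depending on $(\lambda,\delta,\xi')$. Then there exists a positive constant $C$ depending on $\mu_\pm,\nu_+,\varepsilon,\gamma_{1\pm},\gamma_{2+},\lambda_0$ and $b$ (with $\delta_0$ fixed) such that $$|\det\mathbf L|\ge C\big(|\lambda|^{1/2}+|\xi'|\big)^3$$ for any $(\lambda,\xi')\in\Gamma_{\varepsilon,\lambda_0}\times(\mathbb{R}^{N-1}\setminus\{0\})$, in each of the cases (C1), (C2), (C3) for $(\lambda,\delta)$ described in the context.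
   Context: Regions and parameters. $\Sigma_\varepsilon=\{\lambda\in\mathbb{C}\setminus\{0\}:|\arg\lambda|\le\pi-\varepsilon\}$, $\Sigma_{\varepsilon,\lambda_0}=\{\lambda\in\Sigma_\varepsilon:|\lambda|\ge\lambda_0\}$, $K_\varepsilon=\{\lambda\in\mathbb{C}:(\mathrm{Re}\,\lambda+\gamma_{1+}\gamma_{2+}\nu_+^{-1}+\varepsilon)^2+(\mathrm{Im}\,\lambda)^2\ge(\gamma_{1+}\gamma_{2+}\nu_+^{-1}+\varepsilon)^2\}$. The parameters $\lambda,\delta\in\mathbb{C}$ satisfy one of: (C1) $\delta=\gamma_{1+}\gamma_{2+}\lambda^{-1}$ and $\lambda\in\Gamma_{\varepsilon,\lambda_0}:=\Sigma_{\varepsilon,\lambda_0}\cap K_\varepsilon$; (C2) $\delta\in\Sigma_\varepsilon$, $\mathrm{Re}\,\delta<0$, $|\delta|\le\delta_0$, and $\lambda\in\Gamma_{\varepsilon,\lambda_0}:=\{|\lambda|\ge\lambda_0,\ \mathrm{Re}\,\lambda\ge|\mathrm{Re}\,\delta/\mathrm{Im}\,\delta|\,|\mathrm{Im}\,\lambda|\}$; (C3) $\delta\in\Sigma_\varepsilon$, $\mathrm{Re}\,\delta\ge0$, $|\delta|\le\delta_0$, and $\lambda\in\Gamma_{\varepsilon,\lambda_0}:=\{|\lambda|\ge\lambda_0,\ \mathrm{Re}\,\lambda\ge\lambda_0|\mathrm{Im}\,\lambda|\}$. Symbols (square roots are principal). $A=|\xi'|$, $A_+=\sqrt{\gamma_{1+}(\mu_++\nu_++\delta)^{-1}\lambda+A^2}$,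 $B_\pm=\sqrt{\gamma_{1\pm}\mu_\pm^{-1}\lambda+A^2}$, and $$M:=M_-(-b)=\frac{e^{-B_-b}-e^{-Ab}}{B_--A}.$$ Put $$ \begin{aligned} &L_{11}^+=-\mu_+\frac{A_+(B_+^2-A^2)}{A_+B_+-A^2},\qquad L_{12}^+=-\mu_+\frac{A^2(2A_+B_+-A^2-B_+^2)}{A_+B_+-A^2},\\ &L_{21}^+=-A\Big(2\mu_+\frac{A_+(B_+-A_+)}{A_+B_+-A^2}-(\nu_+-\mu_++\delta)\frac{A_+^2-A^2}{A_+B_+-A^2}\Big),\\ &L_{22}^+=-(\mu_++\nu_++\delta)\frac{AB_+(A_+^2-A^2)}{A_+B_+-A^2},\\ &L_{11}^{0-}=-\mu_-(A+B_-),\quad L_{12}^{0-}=-\mu_-(B_--A)A,\quad L_{21}^{0-}=-\mu_-(B_--A),\quad L_{22}^{0-}=-\mu_-(A+B_-)B_-,\\ &L_{11}^{b-}=\mu_-\big((A+B_-)e^{-B_-b}+2A^2M\big),\quad L_{12}^{b-}=-\mu_-\big(2A^2B_-M+(B_--A)Ae^{-B_-b}\big),\\ &L_{21}^{b-}=2\mu_-AB_-M-\mu_-(B_--A)e^{-Ab},\quad L_{22}^{b-}=-2\mu_-A^2B_-M+\mu_-(B_-+A)B_-e^{-Ab}. \end{aligned} $$ For $k=1,2$ put $$\mathfrak L_k=-(AL_{k1}^++L_{k2}^+)(A+B_-)M^2-L_{k1}^{b-}AM+L_{k2}^{b-}M,$$ $$ \begin{aligned} L_{k1}&=L_{k1}^+\big(1-e^{-2B_-b}-2e^{-B_-b}AM\big)+L_{k1}^{0-}-L_{k1}^{b-}e^{-B_-b}+\mathfrak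 L_k,\\ L_{k2}&=L_{k2}^+\big(1-e^{-2B_-b}+2e^{-B_-b}B_-M\big)+L_{k2}^{0-}-L_{k2}^{b-}e^{-B_-b}+B_-\mathfrak L_k. \end{aligned} $$ The matrix $\mathbf L=(L_{jk})_{j,k=1,2}$ arises from the partial Fourier transform in $x'$ of a gas–liquid two-phase resolvent problem in $\{x_N>0\}\cup\{-b<x_N<0\}$. *)

theory Defs
  imports "HOL-Analysis.Analysis"
begin

definition Sigma_sector :: "real \<Rightarrow> complex set" where
  "Sigma_sector \<epsilon> = {lam. lam \<noteq> 0 \<and> \<bar>Arg lam\<bar> \<le> pi - \<epsilon>}"

definition Sigma_sector0 :: "real \<Rightarrow> real \<Rightarrow> complex set" where
  "Sigma_sector0 \<epsilon> lam0 = {lam \<in> Sigma_sector \<epsilon>. cmod lam \<ge> lam0}"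

definition K_region :: "real \<Rightarrow> real \<Rightarrow> real \<Rightarrow> real \<Rightarrow> complex set" where
  "K_region \<gamma>1p \<gamma>2p \<nu>p \<epsilon> =
     {lam. (Re lam + \<gamma>1p * \<gamma>2p / \<nu>p + \<epsilon>)\<^sup>2 + (Im lam)\<^sup>2 \<ge> (\<gamma>1p * \<gamma>2p / \<nu>p + \<epsilon>)\<^sup>2}"

text \<open>The three admissible regimes for the resolvent parameter \<open>lam\<close> (\<open>\<lambda>\<close> in the
  mathematical notation) and \<open>\<delta>\<close>; in each of them the conditions on \<open>lam\<close> alone or on \<open>lam\<close>
  relative to \<open>\<delta>\<close> define the region \<open>\<Gamma>\<close> belonging to that regime.\<close>

definition case_C1 :: "real \<Rightarrow> real \<Rightarrow> real \<Rightarrow> real \<Rightarrow> real \<Rightarrow> complex \<Rightarrow> complex \<Rightarrow> bool" where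
  "case_C1 \<gamma>1p \<gamma>2p \<nu>p \<epsilon> lam0 lam \<delta> \<longleftrightarrow>
     \<delta> = complex_of_real (\<gamma>1p * \<gamma>2p) / lam \<and>
     lam \<in> Sigma_sector0 \<epsilon> lam0 \<inter> K_region \<gamma>1p \<gamma>2p \<nu>p \<epsilon>"

text \<open>In the next definition \<open>Im \<delta> \<noteq> 0\<close> is automatic for \<open>\<epsilon> > 0\<close>, so the quotient is a genuine one.\<close>

definition case_C2 :: "real \<Rightarrow> real \<Rightarrow> real \<Rightarrow> complex \<Rightarrow> complex \<Rightarrow> bool" where
  "case_C2 \<epsilon> lam0 \<delta>\<^sub>0 lam \<delta> \<longleftrightarrow>
     \<delta> \<in> Sigma_sector \<epsilon> \<and> Re \<delta> < 0 \<and> cmod \<delta> \<le> \<delta>\<^sub>0 \<and>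
     cmod lam \<ge> lam0 \<and> Re lam \<ge> \<bar>Re \<delta> / Im \<delta>\<bar> * \<bar>Im lam\<bar>"

definition case_C3 :: "real \<Rightarrow> real \<Rightarrow> real \<Rightarrow> complex \<Rightarrow> complex \<Rightarrow> bool" where
  "case_C3 \<epsilon> lam0 \<delta>\<^sub>0 lam \<delta> \<longleftrightarrow>
     \<delta> \<in> Sigma_sector \<epsilon> \<and> Re \<delta> \<ge> 0 \<and> cmod \<delta> \<le> \<delta>\<^sub>0 \<and>
     cmod lam \<ge> lam0 \<and> Re lam \<ge> lam0 * \<bar>Im lam\<bar>"

text \<open>The symbols depend on the frequency \<open>\<xi>'\<close> only through \<open>A = |\<xi>'|\<close>.  Suffixes \<open>p\<close> and \<open>m\<close>
  stand for the subscripts \<open>+\<close> (gas) and \<open>-\<close> (liquid).  Row and column indices are of type \<open>2\<close>,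
  whose elements are \<open>1\<close> and \<open>2\<close>.\<close>

context
  fixes \<mu>p \<mu>m \<nu>p \<gamma>1p \<gamma>1m b :: real
    and lam \<delta> :: complex
    and A :: real
begin

definition A_plus :: complex where
  "A_plus = csqrt (\<gamma>1p / (\<mu>p + \<nu>p + \<delta>) * lam + A\<^sup>2)"

definition B_plus :: complex where
  "B_plus = csqrt (\<gamma>1p / \<mu>p * lam + A\<^sup>2)"

definition B_minus :: complex where
  "B_minus = csqrt (\<gamma>1m / \<mu>m * lam + A\<^sup>2)"

text \<open>This is \<open>M\<^sub>-(x\<^sub>N) = (exp (B\<^sub>- x\<^sub>N) - exp (A x\<^sub>N)) / (B\<^sub>- - A)\<close> at \<open>x\<^sub>N = -b\<close>.\<close>

definition M_minus :: complex where
  "M_minus = (exp (- B_minus * b) - exp (- A * b)) / (B_minus - A)"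

definition L_plus :: "complex^2^2" where
  "L_plus = vector
    [vector
      [- \<mu>p * (A_plus * (B_plus\<^sup>2 - A\<^sup>2) / (A_plus * B_plus - A\<^sup>2)),
       - \<mu>p * (A\<^sup>2 * (2 * A_plus * B_plus - A\<^sup>2 - B_plus\<^sup>2) / (A_plus * B_plus - A\<^sup>2))],
     vector
      [- A * (2 * \<mu>p * (A_plus * (B_plus - A_plus) / (A_plus * B_plus - A\<^sup>2))
              - (\<nu>p - \<mu>p + \<delta>) * ((A_plus\<^sup>2 - A\<^sup>2) / (A_plus * B_plus - A\<^sup>2))),
       - (\<mu>p + \<nu>p + \<delta>) * (A * B_plus * (A_plus\<^sup>2 - A\<^sup>2) / (A_plus * B_plus - A\<^sup>2))]]"

definition L_0minus :: "complex^2^2" where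
  "L_0minus = vector
    [vector [- \<mu>m * (A + B_minus), - \<mu>m * (B_minus - A) * A],
     vector [- \<mu>m * (B_minus - A), - \<mu>m * (A + B_minus) * B_minus]]"

definition L_bminus :: "complex^2^2" where
  "L_bminus = vector
    [vector
      [\<mu>m * ((A + B_minus) * exp (- B_minus * b) + 2 * A\<^sup>2 * M_minus),
       - \<mu>m * (2 * A\<^sup>2 * B_minus * M_minus + (B_minus - A) * A * exp (- B_minus * b))],
     vector
      [2 * \<mu>m * A * B_minus * M_minus - \<mu>m * (B_minus - A) * exp (- A * b),
       - 2 * \<mu>m * A\<^sup>2 * B_minus * M_minus + \<mu>m * (B_minus + A) * B_minus * exp (- A * b)]]"

definition L_frak :: "2 \<Rightarrow> complex" where
  "L_frak k =
     - (A * L_plus $ k $ 1 + L_plus $ k $ 2) * (A + B_minus) * M_minus\<^sup>2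
     - L_bminus $ k $ 1 * A * M_minus + L_bminus $ k $ 2 * M_minus"

definition Lopatinski_matrix :: "complex^2^2" where
  "Lopatinski_matrix = (\<chi> k. vector
    [L_plus $ k $ 1 * (1 - exp (- 2 * B_minus * b) - 2 * exp (- B_minus * b) * A * M_minus)
       + L_0minus $ k $ 1 - L_bminus $ k $ 1 * exp (- B_minus * b) + L_frak k,
     L_plus $ k $ 2 * (1 - exp (- 2 * B_minus * b) + 2 * exp (- B_minus * b) * B_minus * M_minus)
       + L_0minus $ k $ 2 - L_bminus $ k $ 2 * exp (- B_minus * b) + B_minus * L_frak k])"

end

end

(* The matrix L is P c |-> (stress jump): write a solution in the liquid layer that vanishes at the
   bottom as a combination, with coefficients c, of exponentials; its velocity at the interface is
   (p, q) = diag(1, A) P c, its stress is T c, and L c = N (p, q) - T c, where N is the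
   Dirichlet-to-Neumann matrix of the gas half space.  If L c = 0, multiplying the equations by the
   conjugate velocity and a unit number zeta makes the flux Re (zeta (conj p tau + conj q sigma))
   monotone in x_N; it vanishes at the bottom and at infinity, so the liquid velocity and then c
   vanish.  The only properties of (lambda, delta) needed are Re zeta >= c > 0,
   Re (zeta lambda) >= 0 and Re (zeta (nu + delta)) >= c, and each of (C1), (C2), (C3) provides such
   a zeta.

   The estimate follows by compactness.  L is homogeneous, so one may scale to
   |lambda|^(1/2) + A = 1 with depth b r, where r is the old value of |lambda|^(1/2) + A.  Along a
   sequence violating the bound the scaled symbols converge to a limit that is nonzero: if the depth
   stays finite, by the energy argument (A > 0) or an explicit formula (A = 0); if it tends to
   infinity, by the energy argument for two half spaces (A > 0, lambda nonzero), explicit static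
   elasticity (lambda = 0) or again the formula for A = 0. *)
theory Submission
  imports Defs
begin

section \<open>The determinant as a function of independent symbols\<close>

text \<open>The bound has to survive three regimes in which the formulas for \<open>L\<close> break
  down: the quotients with denominator \<open>A_+ B_+ - A^2\<close> become 0/0 as \<lambda> tends to
  0, \<open>M\<close> loses its denominator when \<open>B_-\<close> tends to \<open>A\<close>, and
  \<open>exp (- A b)\<close> has no definite limit when the frequency tends to 0 while the depth
  tends to infinity. The bound \<open>lam0\<close> on |\<lambda>| enters through the scaling: it
  keeps the reciprocal depth bounded, and it forces the rescaled depth to infinity whenever the
  rescaled \<lambda> tends to 0, so that \<lambda> = 0 occurs only together with the half-space
  problem. The rotation \<zeta> is there because Re \<lambda> can be negative in (C1) and \<nu> + Re
  \<delta> in (C1) and (C2), so that terms of the energy identity could have the wrong sign.\<close>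

definition symbol_col1 :: "complex \<Rightarrow> complex \<Rightarrow> complex \<Rightarrow> complex \<Rightarrow> complex \<Rightarrow> complex \<Rightarrow> complex \<Rightarrow> complex \<Rightarrow> complex \<Rightarrow> complex" where
  "symbol_col1 A Z E M l1 l2 l0 b1 b2 = l1 * (1 - E\<^sup>2 - 2 * E * A * M) + l0 - b1 * E
     + (- (A * l1 + l2) * (A + Z) * M\<^sup>2 - b1 * A * M + b2 * M)"

text \<open>Together with \<open>symbol_col1\<close> this is one row of \<open>L\<close>:
  \<open>l1\<close>, \<open>l2\<close> are its gas entries, \<open>l0\<close> is the entry of
  \<open>L_0minus\<close> in the respective column, and \<open>b1\<close>, \<open>b2\<close> are the
  entries of \<open>L_bminus\<close>. The same pair of formulas serves both rows.\<close>

definition symbol_col2 :: "complex \<Rightarrow> complex \<Rightarrow> complex \<Rightarrow> complex \<Rightarrow> complex \<Rightarrow> complex \<Rightarrow> complex \<Rightarrow> complex \<Rightarrow> complex \<Rightarrow> complex" where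
  "symbol_col2 A Z E M l1 l2 l0 b1 b2 = l2 * (1 - E\<^sup>2 + 2 * E * Z * M) + l0 - b2 * E
     + Z * (- (A * l1 + l2) * (A + Z) * M\<^sup>2 - b1 * A * M + b2 * M)"

text \<open>\<open>A\<close>, \<open>X\<close>, \<open>Y\<close>, \<open>Z\<close> stand for \<open>A\<close>, \<open>A\<^sub>+\<close>, \<open>B\<^sub>+\<close>, \<open>B\<^sub>-\<close>, and \<open>E\<close>, \<open>e\<close> for the two exponentials at depth
  \<open>b\<close>.  The quotients \<open>g = (Y\<^sup>2 - A\<^sup>2) / (X Y - A\<^sup>2)\<close> and \<open>h = (X\<^sup>2 - A\<^sup>2) / (X Y - A\<^sup>2)\<close> are kept as
  arguments of their own because they become \<open>0 / 0\<close> in the limit \<open>\<lambda> \<rightarrow> 0\<close>.\<close>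

definition symbol_det :: "real \<Rightarrow> real \<Rightarrow> real \<Rightarrow> complex \<Rightarrow> complex \<Rightarrow> complex \<Rightarrow> complex \<Rightarrow> complex \<Rightarrow> complex \<Rightarrow> complex \<Rightarrow> complex \<Rightarrow> complex \<Rightarrow> complex \<Rightarrow> complex" where
  "symbol_det \<mu>p \<mu>m \<nu>p \<delta> A X Y Z g h E e M =
    (let l11 = - \<mu>p * (X * g);
         l12 = - \<mu>p * (A\<^sup>2 * (2 - g));
         l21 = - A * (2 * \<mu>p * (X * ((g - h) / (X + Y))) - (\<nu>p - \<mu>p + \<delta>) * h);
         l22 = - (\<mu>p + \<nu>p + \<delta>) * (A * Y * h);
         b11 = \<mu>m * ((A + Z) * E + 2 * A\<^sup>2 * M);
         b12 = - \<mu>m * (2 * A\<^sup>2 * Z * M + (Z - A) * A * E);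
         b21 = 2 * \<mu>m * A * Z * M - \<mu>m * (Z - A) * e;
         b22 = - 2 * \<mu>m * A\<^sup>2 * Z * M + \<mu>m * (Z + A) * Z * e
     in symbol_col1 A Z E M l11 l12 (- \<mu>m * (A + Z)) b11 b12
          * symbol_col2 A Z E M l21 l22 (- \<mu>m * (A + Z) * Z) b21 b22
        - symbol_col2 A Z E M l11 l12 (- \<mu>m * (Z - A) * A) b11 b12
          * symbol_col1 A Z E M l21 l22 (- \<mu>m * (Z - A)) b21 b22)"

text \<open>\<open>g - h\<close> has numerator \<open>Y^2 - X^2\<close>, so the quotient
  \<open>(Y - X) / (X Y - A^2)\<close> in the lower left gas entry is
  \<open>(g - h) / (X + Y)\<close>. All degenerating quotients of the gas are thus absorbed in
  \<open>g\<close> and \<open>h\<close>; the only denominator left, \<open>X + Y\<close>, will be a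
  sum of numbers with positive real part.\<close>

lemma det_Lopatinski_eq_symbol_det:
  assumes "A_plus \<mu>p \<nu>p \<gamma>1p lam \<delta> A + B_plus \<mu>p \<gamma>1p lam A \<noteq> 0"
    and "A_plus \<mu>p \<nu>p \<gamma>1p lam \<delta> A * B_plus \<mu>p \<gamma>1p lam A \<noteq> A\<^sup>2"
  shows "det (Lopatinski_matrix \<mu>p \<mu>m \<nu>p \<gamma>1p \<gamma>1m b lam \<delta> A) =
    (let X = A_plus \<mu>p \<nu>p \<gamma>1p lam \<delta> A; Y = B_plus \<mu>p \<gamma>1p lam A; Z = B_minus \<mu>m \<gamma>1m lam A in
     symbol_det \<mu>p \<mu>m \<nu>p \<delta> A X Y Z ((Y\<^sup>2 - A\<^sup>2) / (X * Y - A\<^sup>2)) ((X\<^sup>2 - A\<^sup>2) / (X * Y - A\<^sup>2))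
       (exp (- Z * b)) (exp (- A * b)) (M_minus \<mu>m \<gamma>1m b lam A))"
proof -
  define X where "X = A_plus \<mu>p \<nu>p \<gamma>1p lam \<delta> A"
  define Y where "Y = B_plus \<mu>p \<gamma>1p lam A"
  define Z where "Z = B_minus \<mu>m \<gamma>1m lam A"
  define M where "M = M_minus \<mu>m \<gamma>1m b lam A"
  define g where "g = (Y\<^sup>2 - A\<^sup>2) / (X * Y - A\<^sup>2)"
  define h where "h = (X\<^sup>2 - A\<^sup>2) / (X * Y - A\<^sup>2)"
  have nz: "X + Y \<noteq> 0" "X * Y - A\<^sup>2 \<noteq> 0"
    using assms unfolding X_def Y_def by auto
  have E2: "exp (- 2 * Z * b) = (exp (- Z * b))\<^sup>2"
    by (simp add: power2_eq_square mult.assoc flip: exp_add)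
  have e1: "X * (Y\<^sup>2 - A\<^sup>2) / (X * Y - A\<^sup>2) = X * g" by (simp add: g_def)
  have e2: "A\<^sup>2 * (2 * X * Y - A\<^sup>2 - Y\<^sup>2) / (X * Y - A\<^sup>2) = A\<^sup>2 * (2 - g)"
    using nz unfolding g_def by (simp add: field_simps)
  have e3: "X * (Y - X) / (X * Y - A\<^sup>2) = X * ((g - h) / (X + Y))"
    using nz unfolding g_def h_def by (simp add: divide_simps) (simp add: algebra_simps power2_eq_square)
  have e4: "A * Y * (X\<^sup>2 - A\<^sup>2) / (X * Y - A\<^sup>2) = A * Y * h" by (simp add: h_def)
  show ?thesis
    unfolding det_2 Let_def symbol_det_def symbol_col1_def symbol_col2_def
    unfolding Lopatinski_matrix_def L_frak_def L_plus_def L_0minus_def L_bminus_def vec_lambda_beta vector_2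
    unfolding X_def[symmetric] Y_def[symmetric] Z_def[symmetric] M_def[symmetric]
    unfolding e1 e2 e3 e4 E2 g_def[symmetric] h_def[symmetric] 
    by simp
qed

text \<open>Here \<open>(p, q)\<close> is the velocity at the interface and the two equations say that the tangential
  and normal stresses agree; \<open>(d1, d2)\<close> are the coefficients of the correction that enforces the
  no-slip condition at the bottom.\<close>

lemma symbol_det_kernel:
  assumes "symbol_det \<mu>p \<mu>m \<nu>p \<delta> A X Y Z g h E e M = 0"
  obtains c1 c2 d1 d2 p q where "c1 \<noteq> 0 \<or> c2 \<noteq> 0"
    "d1 = c1 * E + A * M * (c1 + Z * c2)" "d2 = c2 * E - M * (c1 + Z * c2)"
    "p = c1 - d1 * E - A * M * (d1 - Z * d2)" "q = A * (c2 - d2 * E - M * (d1 - Z * d2))"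
    "- \<mu>p * X * g * p - \<mu>p * A * (2 - g) * q =
       \<mu>m * ((A + Z) * c1 + (Z - A) * A * c2) + \<mu>m * ((A + Z) * E + 2 * A\<^sup>2 * M) * d1
       - \<mu>m * (2 * A\<^sup>2 * Z * M + (Z - A) * A * E) * d2"
    "- A * (2 * \<mu>p * (X * ((g - h) / (X + Y))) - (\<nu>p - \<mu>p + \<delta>) * h) * p - (\<mu>p + \<nu>p + \<delta>) * Y * h * q =
       \<mu>m * ((Z - A) * c1 + (A + Z) * Z * c2) + \<mu>m * (2 * A * Z * M - (Z - A) * e) * d1
       + \<mu>m * (- 2 * A\<^sup>2 * Z * M + (Z + A) * Z * e) * d2"
proof -
  define l11 where "l11 = - \<mu>p * (X * g)"
  define l12 where "l12 = - \<mu>p * (A\<^sup>2 * (2 - g))"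
  define l21 where "l21 = - A * (2 * \<mu>p * (X * ((g - h) / (X + Y))) - (\<nu>p - \<mu>p + \<delta>) * h)"
  define l22 where "l22 = - (\<mu>p + \<nu>p + \<delta>) * (A * Y * h)"
  define b11 where "b11 = \<mu>m * ((A + Z) * E + 2 * A\<^sup>2 * M)"
  define b12 where "b12 = - \<mu>m * (2 * A\<^sup>2 * Z * M + (Z - A) * A * E)"
  define b21 where "b21 = 2 * \<mu>m * A * Z * M - \<mu>m * (Z - A) * e"
  define b22 where "b22 = - 2 * \<mu>m * A\<^sup>2 * Z * M + \<mu>m * (Z + A) * Z * e"
  define f1 where "f1 = - (A * l11 + l12) * (A + Z) * M\<^sup>2 - b11 * A * M + b12 * M"
  define f2 where "f2 = - (A * l21 + l22) * (A + Z) * M\<^sup>2 - b21 * A * M + b22 * M"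
  define L11 where "L11 = l11 * (1 - E\<^sup>2 - 2 * E * A * M) + - \<mu>m * (A + Z) - b11 * E + f1"
  define L12 where "L12 = l12 * (1 - E\<^sup>2 + 2 * E * Z * M) + - \<mu>m * (Z - A) * A - b12 * E + Z * f1"
  define L21 where "L21 = l21 * (1 - E\<^sup>2 - 2 * E * A * M) + - \<mu>m * (Z - A) - b21 * E + f2"
  define L22 where "L22 = l22 * (1 - E\<^sup>2 + 2 * E * Z * M) + - \<mu>m * (A + Z) * Z - b22 * E + Z * f2"
  have "L11 * L22 - L12 * L21 = 0"
    using assms unfolding symbol_det_def symbol_col1_def symbol_col2_def Let_def L11_def L12_def L21_def L22_def f1_def f2_def
      l11_def l12_def l21_def l22_def b11_def b12_def b21_def b22_def by simp
  then have det: "L11 * L22 = L12 * L21" by simp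
  have "\<exists>c1 c2. (c1 \<noteq> 0 \<or> c2 \<noteq> 0) \<and> L11 * c1 + L12 * c2 = 0 \<and> L21 * c1 + L22 * c2 = 0"
  proof (cases "L11 = 0 \<and> L12 = 0")
    case True
    then show ?thesis
      by (intro exI[of _ "if L21 = 0 \<and> L22 = 0 then 1 else L22"] exI[of _ "- L21"]) auto
  next
    case False
    then show ?thesis using det
      by (intro exI[of _ "L12"] exI[of _ "- L11"]) (auto simp: mult.commute)
  qed
  then obtain c1 c2 where c: "c1 \<noteq> 0 \<or> c2 \<noteq> 0" and r1: "L11 * c1 + L12 * c2 = 0"
    and r2: "L21 * c1 + L22 * c2 = 0" by blast
  \<comment> \<open>\<open>(c1, A c2)\<close> is the interface velocity of the modes that decay away
    from the interface, and \<open>(d1, A d2)\<close> is their velocity at the bottom, which the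
    correction has to cancel.\<close>
  define d1 where "d1 = c1 * E + A * M * (c1 + Z * c2)"
  define d2 where "d2 = c2 * E - M * (c1 + Z * c2)"
  define p where "p = c1 - d1 * E - A * M * (d1 - Z * d2)"
  define q' where "q' = (c2 - d2 * E - M * (d1 - Z * d2))"
  \<comment> \<open>Transport to the bottom and back makes \<open>p\<close> and \<open>q'\<close>
    quadratic in \<open>E\<close> and \<open>M\<close>; this accounts for the squares in
    \<open>L\<close>. Here \<open>q = A q'\<close>, and the factor \<open>A\<close> is contained in
    \<open>l12\<close> and \<open>l22\<close>.\<close>
  have s1: "L11 * c1 + L12 * c2 = l11 * p + l12 * q' - \<mu>m * ((A + Z) * c1 + (Z - A) * A * c2) - b11 * d1 - b12 * d2"
    unfolding L11_def L12_def f1_def p_def q'_def d1_def d2_def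
    by (simp add: algebra_simps power2_eq_square)
  have s2: "L21 * c1 + L22 * c2 = l21 * p + l22 * q' - \<mu>m * ((Z - A) * c1 + (A + Z) * Z * c2) - b21 * d1 - b22 * d2"
    unfolding L21_def L22_def f2_def p_def q'_def d1_def d2_def
    by (simp add: algebra_simps power2_eq_square)
  show thesis
  proof (rule that[OF c d1_def d2_def p_def refl])
    show "- \<mu>p * X * g * p - \<mu>p * A * (2 - g) * (A * (c2 - d2 * E - M * (d1 - Z * d2))) =
       \<mu>m * ((A + Z) * c1 + (Z - A) * A * c2) + \<mu>m * ((A + Z) * E + 2 * A\<^sup>2 * M) * d1
       - \<mu>m * (2 * A\<^sup>2 * Z * M + (Z - A) * A * E) * d2"
      using r1 unfolding s1 q'_def[symmetric] l11_def l12_def b11_def b12_def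
      by (simp add: algebra_simps power2_eq_square)
    show "- A * (2 * \<mu>p * (X * ((g - h) / (X + Y))) - (\<nu>p - \<mu>p + \<delta>) * h) * p
         - (\<mu>p + \<nu>p + \<delta>) * Y * h * (A * (c2 - d2 * E - M * (d1 - Z * d2))) =
       \<mu>m * ((Z - A) * c1 + (A + Z) * Z * c2) + \<mu>m * (2 * A * Z * M - (Z - A) * e) * d1
       + \<mu>m * (- 2 * A\<^sup>2 * Z * M + (Z + A) * Z * e) * d2"
      using r2 unfolding s2 q'_def[symmetric] l21_def l22_def b21_def b22_def
      by (simp add: algebra_simps)
  qed
qed

text \<open>Subtracting from the stress the one that the upper half space \<open>x\<^sub>N > -b\<close> would produce for the
  same interface velocity removes the correction and isolates \<open>2 \<mu>\<^sub>- (A + Z) (c1, Z c2)\<close>.\<close>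

lemma liquid_data_determine_coefficients:
  fixes \<mu>m :: real and A Z E M c1 c2 :: complex
  assumes "d1 = c1 * E + A * M * (c1 + Z * c2)" "d2 = c2 * E - M * (c1 + Z * c2)"
    and p: "c1 - d1 * E - A * M * (d1 - Z * d2) = 0" and q: "c2 - d2 * E - M * (d1 - Z * d2) = 0"
    and e: "e = E - (Z - A) * M"
    and t1: "\<mu>m * ((A + Z) * c1 + (Z - A) * A * c2) + \<mu>m * ((A + Z) * E + 2 * A\<^sup>2 * M) * d1
       - \<mu>m * (2 * A\<^sup>2 * Z * M + (Z - A) * A * E) * d2 = 0"
    and t2: "\<mu>m * ((Z - A) * c1 + (A + Z) * Z * c2) + \<mu>m * (2 * A * Z * M - (Z - A) * e) * d1
       + \<mu>m * (- 2 * A\<^sup>2 * Z * M + (Z + A) * Z * e) * d2 = 0"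
    and "\<mu>m \<noteq> 0" "A + Z \<noteq> 0" "Z \<noteq> 0"
  shows "c1 = 0 \<and> c2 = 0"
proof -
  have "2 * \<mu>m * (A + Z) * c1 = \<mu>m * ((A + Z) * c1 + (Z - A) * A * c2) + \<mu>m * ((A + Z) * E + 2 * A\<^sup>2 * M) * d1
       - \<mu>m * (2 * A\<^sup>2 * Z * M + (Z - A) * A * E) * d2
      + \<mu>m * (A + Z) * (c1 - d1 * E - A * M * (d1 - Z * d2)) - \<mu>m * (Z - A) * A * (c2 - d2 * E - M * (d1 - Z * d2))"
    by (simp add: algebra_simps power2_eq_square)
  then have c1: "c1 = 0" using p q t1 assms(8,9) by simp
  have "2 * \<mu>m * (A + Z) * Z * c2 = \<mu>m * ((Z - A) * c1 + (A + Z) * Z * c2) + \<mu>m * (2 * A * Z * M - (Z - A) * e) * d1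
       + \<mu>m * (- 2 * A\<^sup>2 * Z * M + (Z + A) * Z * e) * d2
      - \<mu>m * (Z - A) * (c1 - d1 * E - A * M * (d1 - Z * d2)) + \<mu>m * Z * (Z + A) * (c2 - d2 * E - M * (d1 - Z * d2))"
    unfolding e by (simp add: algebra_simps power2_eq_square)
  then have "c2 = 0" using p q t2 assms(8-10) by simp
  with c1 show ?thesis by simp
qed

text \<open>The coefficient \<open>c2\<close> is a velocity divided by a frequency, so column 2 has
  one degree more than column 1. The determinant gets degree 1 + 2 = 3, and \<open>M\<close>, a
  quotient by a root, has degree -1.\<close>

lemma symbol_col_homogeneous:
  "symbol_col1 (r * A) (r * Z) E M (r * l1) (r\<^sup>2 * l2) (r * l0) (r * b1) (r\<^sup>2 * b2) = r * symbol_col1 A Z E (r * M) l1 l2 l0 b1 b2"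
  "symbol_col2 (r * A) (r * Z) E M (r * l1) (r\<^sup>2 * l2) (r\<^sup>2 * l0) (r * b1) (r\<^sup>2 * b2) = r\<^sup>2 * symbol_col2 A Z E (r * M) l1 l2 l0 b1 b2"
  unfolding symbol_col1_def symbol_col2_def by (simp_all add: algebra_simps power2_eq_square)

text \<open>The exponentials keep their values: dividing the frequencies by \<open>r\<close> goes
  with multiplying the depth by \<open>r\<close>.\<close>

lemma symbol_det_homogeneous:
  fixes r :: complex
  assumes "r \<noteq> 0"
  shows "symbol_det \<mu>p \<mu>m \<nu>p \<delta> (r * A) (r * X) (r * Y) (r * Z) g h E e M
    = r ^ 3 * symbol_det \<mu>p \<mu>m \<nu>p \<delta> A X Y Z g h E e (r * M)"
proof -
  define u where "u = (g - h) / (X + Y)"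
  have u: "r * X * ((g - h) / (r * X + r * Y)) = X * u"
    using assms by (simp add: u_def flip: distrib_left)
  define l11 where "l11 = - \<mu>p * (X * g)"
  define l12 where "l12 = - \<mu>p * (A\<^sup>2 * (2 - g))"
  define l21 where "l21 = - A * (2 * \<mu>p * (X * u) - (\<nu>p - \<mu>p + \<delta>) * h)"
  define l22 where "l22 = - (\<mu>p + \<nu>p + \<delta>) * (A * Y * h)"
  define b11 where "b11 = \<mu>m * ((A + Z) * E + 2 * A\<^sup>2 * (r * M))"
  define b12 where "b12 = - \<mu>m * (2 * A\<^sup>2 * Z * (r * M) + (Z - A) * A * E)"
  define b21 where "b21 = 2 * \<mu>m * A * Z * (r * M) - \<mu>m * (Z - A) * e"
  define b22 where "b22 = - 2 * \<mu>m * A\<^sup>2 * Z * (r * M) + \<mu>m * (Z + A) * Z * e"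
  note defs = l11_def l12_def l21_def l22_def b11_def b12_def b21_def b22_def
  let ?c1 = "symbol_col1 (r * A) (r * Z) E M" and ?c2 = "symbol_col2 (r * A) (r * Z) E M"
    and ?C1 = "symbol_col1 A Z E (r * M)" and ?C2 = "symbol_col2 A Z E (r * M)"
  have "symbol_det \<mu>p \<mu>m \<nu>p \<delta> (r * A) (r * X) (r * Y) (r * Z) g h E e M =
      ?c1 (r * l11) (r\<^sup>2 * l12) (r * (- \<mu>m * (A + Z))) (r * b11) (r\<^sup>2 * b12)
    * ?c2 (r * l21) (r\<^sup>2 * l22) (r\<^sup>2 * (- \<mu>m * (A + Z) * Z)) (r * b21) (r\<^sup>2 * b22)
    - ?c2 (r * l11) (r\<^sup>2 * l12) (r\<^sup>2 * (- \<mu>m * (Z - A) * A)) (r * b11) (r\<^sup>2 * b12)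
    * ?c1 (r * l21) (r\<^sup>2 * l22) (r * (- \<mu>m * (Z - A))) (r * b21) (r\<^sup>2 * b22)"
    unfolding symbol_det_def Let_def u defs by (simp add: algebra_simps power2_eq_square)
  also have "\<dots> = r ^ 3 * (?C1 l11 l12 (- \<mu>m * (A + Z)) b11 b12 * ?C2 l21 l22 (- \<mu>m * (A + Z) * Z) b21 b22
      - ?C2 l11 l12 (- \<mu>m * (Z - A) * A) b11 b12 * ?C1 l21 l22 (- \<mu>m * (Z - A)) b21 b22)"
    unfolding symbol_col_homogeneous by algebra
  also have "\<dots> = r ^ 3 * symbol_det \<mu>p \<mu>m \<nu>p \<delta> A X Y Z g h E e (r * M)"
    unfolding symbol_det_def Let_def u_def[symmetric] defs by simp
  finally show ?thesis .
qed

lemma symbol_det_tendsto: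
  assumes "(d \<longlongrightarrow> d0) F" "(A \<longlongrightarrow> A0) F" "(X \<longlongrightarrow> X0) F" "(Y \<longlongrightarrow> Y0) F" "(Z \<longlongrightarrow> Z0) F" "(g \<longlongrightarrow> g0) F" "(h \<longlongrightarrow> h0) F"
    "(E \<longlongrightarrow> E0) F" "(e \<longlongrightarrow> e0) F" "(M \<longlongrightarrow> M0) F" "X0 + Y0 \<noteq> 0"
  shows "((\<lambda>n. symbol_det \<mu>p \<mu>m \<nu>p (d n) (A n) (X n) (Y n) (Z n) (g n) (h n) (E n) (e n) (M n))
     \<longlongrightarrow> symbol_det \<mu>p \<mu>m \<nu>p d0 A0 X0 Y0 Z0 g0 h0 E0 e0 M0) F"
  unfolding symbol_det_def symbol_col1_def symbol_col2_def Let_def by (intro tendsto_intros assms)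

text \<open>For \<open>A = 0\<close> the upper right entry vanishes, so the determinant is the
  product of the diagonal entries. The assumption is what the definition of \<open>M\<close>
  becomes; \<open>e\<close> stays free, because it may be any limit of exponentials whose frequency
  tends to 0.\<close>

lemma symbol_det_zero_frequency:
  assumes "Z * M = E - e"
  shows "symbol_det \<mu>p \<mu>m \<nu>p \<delta> 0 X Y Z g h E e M = \<mu>m * Z\<^sup>2 * (1 + e\<^sup>2) * (\<mu>p * (X * g) * (1 - E\<^sup>2) + \<mu>m * Z * (1 + E\<^sup>2))"
proof -
  have "symbol_det \<mu>p \<mu>m \<nu>p \<delta> 0 X Y Z g h E e M =
    (\<mu>p * (X * g) * (1 - E\<^sup>2) + \<mu>m * Z * (1 + E\<^sup>2)) * (\<mu>m * Z\<^sup>2 * (1 + e * E) - \<mu>m * Z * Z * e * (Z * M))"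
    unfolding symbol_det_def symbol_col1_def symbol_col2_def Let_def by (simp add: algebra_simps power2_eq_square)
  then show ?thesis unfolding assms by (simp add: algebra_simps power2_eq_square)
qed

text \<open>Divided by \<open>Z\<close>, the last factor is
  \<open>(\<mu>p \<kappa> + \<mu>m) - (\<mu>p \<kappa> - \<mu>m) E^2\<close>, whose first term
  dominates the second. \<kappa> will be the ratio of \<open>B_+\<close> to \<open>B_-\<close>, a
  positive number at zero frequency.\<close>

lemma symbol_det_zero_frequency_nonzero:
  fixes \<kappa> e :: real and X Z E M :: complex
  assumes "Z * M = E - e" "\<mu>p > 0" "\<mu>m > 0" "Re Z > 0" "X * g = \<kappa> * Z" "\<kappa> > 0" "cmod E < 1"
  shows "symbol_det \<mu>p \<mu>m \<nu>p \<delta> 0 X Y Z g h E e M \<noteq> 0"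
proof -
  have Z: "Z \<noteq> 0" using assms by auto
  have "1 + (complex_of_real e)\<^sup>2 = of_real (1 + e\<^sup>2)" by simp
  moreover have "1 + e\<^sup>2 > 0" by (simp add: add_pos_nonneg)
  ultimately have e: "1 + (complex_of_real e)\<^sup>2 \<noteq> 0" by (metis of_real_eq_0_iff less_irrefl)
  have "\<mu>p * \<kappa> * (1 - E\<^sup>2) + \<mu>m * (1 + E\<^sup>2) \<noteq> 0"
  proof
    assume *: "\<mu>p * \<kappa> * (1 - E\<^sup>2) + \<mu>m * (1 + E\<^sup>2) = 0"
    have "of_real (\<mu>p * \<kappa> + \<mu>m) - of_real (\<mu>p * \<kappa> - \<mu>m) * E\<^sup>2 = \<mu>p * \<kappa> * (1 - E\<^sup>2) + \<mu>m * (1 + E\<^sup>2)"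
      by (simp add: algebra_simps)
    then have "of_real (\<mu>p * \<kappa> + \<mu>m) = of_real (\<mu>p * \<kappa> - \<mu>m) * E\<^sup>2" using * by simp
    then have "\<bar>\<mu>p * \<kappa> + \<mu>m\<bar> = \<bar>\<mu>p * \<kappa> - \<mu>m\<bar> * (cmod E)\<^sup>2"
      by (subst norm_of_real[symmetric, where 'a = complex]) (simp only: norm_mult norm_of_real norm_power)
    also have "\<dots> \<le> \<bar>\<mu>p * \<kappa> - \<mu>m\<bar> * 1"
      using assms(7) by (intro mult_left_mono power_le_one) auto
    also have "\<dots> < \<bar>\<mu>p * \<kappa> + \<mu>m\<bar>" using mult_pos_pos[OF assms(2,6)] assms(3) by (auto simp: abs_if)
    finally show False by simp
  qed
  moreover have "\<mu>p * (X * g) * (1 - E\<^sup>2) + \<mu>m * Z * (1 + E\<^sup>2) = Z * (\<mu>p * \<kappa> * (1 - E\<^sup>2) + \<mu>m * (1 + E\<^sup>2))"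
    unfolding assms(5) by (simp add: algebra_simps)
  ultimately show ?thesis
    unfolding symbol_det_zero_frequency[OF assms(1)] using Z e assms(2,3) by simp
qed

text \<open>The limit \<open>\<lambda> = 0\<close>, \<open>A = 1\<close>, where all roots equal \<open>1\<close>.\<close>

lemma symbol_det_elastic_nonzero:
  fixes \<mu>p \<mu>m \<nu>p :: real and \<delta> :: complex
  assumes pos: "\<mu>p > 0" "\<mu>m > 0" and \<zeta>: "Re \<zeta> > 0" "Re (\<zeta> * (\<nu>p + \<delta>)) \<ge> 0"
    and g: "g * (2 * \<mu>p + \<nu>p + \<delta>) = 2 * (\<mu>p + \<nu>p + \<delta>)" and h: "h * (2 * \<mu>p + \<nu>p + \<delta>) = 2 * \<mu>p"
  shows "symbol_det \<mu>p \<mu>m \<nu>p \<delta> 1 1 1 1 g h 0 0 0 \<noteq> 0"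
proof -
  define t where "t = 2 * \<mu>p + \<nu>p + \<delta>"
  \<comment> \<open>Multiplication by \<zeta> gives every such combination a positive real
    part.\<close>
  have neq: "complex_of_real x + y * (\<nu>p + \<delta>) \<noteq> 0" if "x > 0" "y \<ge> 0" for x y :: real
  proof
    assume "complex_of_real x + y * (\<nu>p + \<delta>) = 0"
    then have "Re (\<zeta> * (complex_of_real x + y * (\<nu>p + \<delta>))) = 0" by simp
    moreover have "Re (\<zeta> * (complex_of_real x + y * (\<nu>p + \<delta>))) = x * Re \<zeta> + y * Re (\<zeta> * (\<nu>p + \<delta>))"
      by (simp add: algebra_simps)
    moreover have "x * Re \<zeta> > 0" "y * Re (\<zeta> * (\<nu>p + \<delta>)) \<ge> 0" using \<zeta> that by simp_all
    ultimately show False by linarith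
  qed
  have t: "t \<noteq> 0" using neq[of "2 * \<mu>p" 1] pos by (simp add: t_def algebra_simps)
  have gh: "g = 2 * (t - \<mu>p) / t" "h = 2 * \<mu>p / t"
    using g h t unfolding t_def by (simp_all add: field_simps)
  \<comment> \<open>Both diagonal entries equal \<open>x\<close> and both off-diagonal entries equal
    \<open>y\<close>; hence \<open>x + y\<close> and \<open>x - y\<close> are the eigenvalues, for
    the vectors (1, 1) and (1, -1).\<close>
  define x where "x = - \<mu>p * g - 2 * \<mu>m"
  define y where "y = - 2 * \<mu>p * \<mu>p / t"
  have "symbol_det \<mu>p \<mu>m \<nu>p \<delta> 1 1 1 1 g h 0 0 0 = x * (- (t - \<mu>p) * h - 2 * \<mu>m) - (- \<mu>p * (2 - g)) * (- (\<mu>p * (g - h) - (t - 3 * \<mu>p) * h))"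
    unfolding symbol_det_def symbol_col1_def symbol_col2_def Let_def x_def t_def by (simp add: field_simps)
  also have "- (t - \<mu>p) * h - 2 * \<mu>m = x"
    unfolding x_def gh by (simp add: field_simps)
  also have "- \<mu>p * (2 - g) = y"
    unfolding y_def gh using t by (simp add: field_simps)
  also have "- (\<mu>p * (g - h) - (t - 3 * \<mu>p) * h) = y"
    unfolding y_def gh using t by (simp add: field_simps)
  also have "x * x - y * y = (x + y) * (x - y)" by (simp add: algebra_simps)
  finally have s: "symbol_det \<mu>p \<mu>m \<nu>p \<delta> 1 1 1 1 g h 0 0 0 = (x + y) * (x - y)" .
  have "x + y = - of_real (2 * \<mu>p + 2 * \<mu>m)"
    unfolding x_def y_def gh using t by (simp add: field_simps)
  then have 1: "x + y \<noteq> 0" using pos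
    by (metis add_pos_pos less_irrefl mult_pos_pos neg_equal_0_iff_equal of_real_eq_0_iff zero_less_numeral)
  define w where "w = of_real (2 * \<mu>p * \<mu>m) + (\<mu>p + \<mu>m) * (\<nu>p + \<delta>)"
  have "t * (x - y) = - 2 * w"
    unfolding x_def y_def gh using t by (simp add: field_simps) (simp add: w_def t_def algebra_simps)
  moreover have "w \<noteq> 0" unfolding w_def
    using neq[of "2 * \<mu>p * \<mu>m" "\<mu>p + \<mu>m"] pos by simp
  ultimately have 2: "x - y \<noteq> 0" by auto
  show ?thesis using 1 2 s by simp
qed

section \<open>Energy flux in the gas and in the liquid\<close>

text \<open>The velocity amplitudes are \<open>(- \<i> p, q)\<close>, so that the divergence is \<open>A p + q'\<close> and all
  coefficients of the transformed equations are free of \<open>\<i>\<close>; \<open>P\<close>, \<open>Q\<close> are the derivatives of \<open>p\<close>,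
  \<open>q\<close>, and \<open>\<tau>\<close>, \<open>\<sigma>\<close> are the tangential and normal stresses.\<close>

lemma gas_flux_identity:
  fixes p q P Q \<tau> \<sigma> \<kappa> lam :: complex and \<mu> \<gamma> A :: real
  assumes "\<tau> = \<mu> * (P - A * q)" "\<sigma> = \<kappa> * Q + (\<kappa> - 2 * \<mu>) * A * p"
  shows "cnj P * \<tau> + cnj p * (\<gamma> * lam * p + A * (2 * \<mu> * A * p + (\<kappa> - 2 * \<mu>) * (A * p + Q)))
       + (cnj Q * \<sigma> + cnj q * (\<gamma> * lam * q - A * \<tau>))
     = \<gamma> * lam * (of_real ((cmod p)\<^sup>2 + (cmod q)\<^sup>2)) + of_real (\<mu> * (cmod (P - A * q))\<^sup>2 + \<mu> * (cmod (A * p - Q))\<^sup>2)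
       + (\<kappa> - \<mu>) * of_real ((cmod (A * p + Q))\<^sup>2)"
  unfolding assms of_real_add of_real_mult complex_norm_square
  by (simp add: algebra_simps)

text \<open>Incompressibility leaves the pressure as an unknown, contained in \<sigma>. The state is
  therefore \<open>(p, q, \<tau>, \<sigma>)\<close>, with \<open>q' = - A p\<close> and with
  \<open>p'\<close> read off from \<tau>; the last term on the right is the viscous
  dissipation.\<close>

lemma liquid_flux_identity:
  fixes p q \<tau> \<sigma> lam :: complex and \<mu> \<gamma> A :: real
  assumes "\<mu> \<noteq> 0"
  shows "cnj (\<tau> / \<mu> + A * q) * \<tau> + cnj p * ((\<gamma> * lam + 4 * \<mu> * A\<^sup>2) * p + A * \<sigma>)
       + (cnj (- A * p) * \<sigma> + cnj q * (\<gamma> * lam * q - A * \<tau>))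
     = \<gamma> * lam * (of_real ((cmod p)\<^sup>2 + (cmod q)\<^sup>2)) + of_real (4 * \<mu> * A\<^sup>2 * (cmod p)\<^sup>2 + (cmod \<tau>)\<^sup>2 / \<mu>)"
  using assms unfolding of_real_add of_real_mult of_real_divide complex_norm_square
  by (simp add: field_simps)

lemma flux_has_derivative:
  fixes p q \<tau> \<sigma> :: "real \<Rightarrow> complex"
  assumes "(p has_vector_derivative p') (at x)" "(q has_vector_derivative q') (at x)"
    "(\<tau> has_vector_derivative \<tau>') (at x)" "(\<sigma> has_vector_derivative \<sigma>') (at x)"
  shows "((\<lambda>x. Re (\<zeta> * (cnj (p x) * \<tau> x + cnj (q x) * \<sigma> x))) has_real_derivative
    Re (\<zeta> * (cnj p' * \<tau> x + cnj (p x) * \<tau>' + (cnj q' * \<sigma> x + cnj (q x) * \<sigma>')))) (at x)"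
proof -
  note c = bounded_linear.has_vector_derivative[OF bounded_linear_cnj]
  have "((\<lambda>x. Re (\<zeta> * (cnj (p x) * \<tau> x + cnj (q x) * \<sigma> x))) has_vector_derivative
    Re (\<zeta> * (cnj (p x) * \<tau>' + cnj p' * \<tau> x + (cnj (q x) * \<sigma>' + cnj q' * \<sigma> x)))) (at x)"
    by (intro bounded_linear.has_vector_derivative[OF bounded_linear_Re]
       bounded_linear.has_vector_derivative[OF bounded_linear_mult_right]
       has_vector_derivative_add has_vector_derivative_mult c assms)
  then show ?thesis
    by (simp add: has_real_derivative_iff_has_vector_derivative add.commute)
qed

lemma exp_mode_has_derivative:
  fixes k a :: complex
  shows "((\<lambda>x. a * exp (k * of_real x)) has_vector_derivative a * k * exp (k * of_real x)) (at x)"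
  by (rule has_vector_derivative_real_field) (auto intro!: derivative_eq_intros)

lemma exp_mode_tendsto:
  fixes k a :: complex
  assumes "Re k < 0"
  shows "((\<lambda>x. a * exp (k * of_real x)) \<longlongrightarrow> 0) at_top"
proof -
  have "((\<lambda>x. exp (Re k * x)) \<longlongrightarrow> 0) at_top"
    by (rule filterlim_compose[OF exp_at_bot])
       (use assms in \<open>auto intro: filterlim_tendsto_neg_mult_at_bot[OF tendsto_const] filterlim_ident\<close>)
  then have "((\<lambda>x. exp (k * of_real x)) \<longlongrightarrow> 0) at_top"
    by (rule Lim_null_comparison[rotated]) (auto simp: norm_exp_eq_Re)
  then show ?thesis by (rule tendsto_mult_right_zero)
qed

text \<open>\<alpha> and \<beta> are the amplitudes of the gradient mode with exponent
  \<open>- X\<close> and of the divergence-free mode with exponent \<open>- Y\<close>; the first two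
  assumptions are their dispersion relations. \<kappa> stands for
  \<open>\<mu>p + \<nu>p + \<delta>\<close>.\<close>

lemma gas_flux_nonpos:
  fixes \<alpha> \<beta> X Y \<kappa> lam \<zeta> :: complex and \<mu> \<gamma> A :: real
  assumes X: "\<gamma> * lam = \<kappa> * (X\<^sup>2 - A\<^sup>2)" and Y: "\<gamma> * lam = \<mu> * (Y\<^sup>2 - A\<^sup>2)"
    and re: "Re X > 0" "Re Y > 0" and pos: "\<mu> > 0" "\<gamma> > 0"
    and \<zeta>: "Re \<zeta> \<ge> 0" "Re (\<zeta> * lam) \<ge> 0" "Re (\<zeta> * (\<kappa> - \<mu>)) \<ge> 0"
    and p: "p = - A * \<alpha> + Y * \<beta>" and q: "q = - X * \<alpha> + A * \<beta>"
    and t: "\<tau> = \<mu> * (2 * A * X * \<alpha> - (Y\<^sup>2 + A\<^sup>2) * \<beta>)"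
    and s: "\<sigma> = (\<kappa> * X\<^sup>2 - (\<kappa> - 2 * \<mu>) * A\<^sup>2) * \<alpha> - 2 * \<mu> * A * Y * \<beta>"
  shows "Re (\<zeta> * (cnj p * \<tau> + cnj q * \<sigma>)) \<le> 0"
proof -
  define ex where "ex = (\<lambda>(k::complex) (x::real). exp (k * of_real x))"
  define mode where "mode = (\<lambda>a b x. a * ex (- X) x + b * ex (- Y) x)"
  have mode_deriv: "(mode a b has_vector_derivative mode (- X * a) (- Y * b) x) (at x)" for a b x
    unfolding mode_def ex_def
    by (rule has_vector_derivative_eq_rhs, rule has_vector_derivative_add[OF exp_mode_has_derivative exp_mode_has_derivative]) simp
  have mode_lim: "(mode a b \<longlongrightarrow> 0) at_top" for a b
    unfolding mode_def ex_def
    using tendsto_add[OF exp_mode_tendsto exp_mode_tendsto, of "- X" "- Y" a b] re by simp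
  define P where "P = mode (- A * \<alpha>) (Y * \<beta>)"
  define Q where "Q = mode (- X * \<alpha>) (A * \<beta>)"
  define T where "T = mode (\<mu> * (2 * A * X * \<alpha>)) (- \<mu> * (Y\<^sup>2 + A\<^sup>2) * \<beta>)"
  define S where "S = mode ((\<kappa> * X\<^sup>2 - (\<kappa> - 2 * \<mu>) * A\<^sup>2) * \<alpha>) (- 2 * \<mu> * A * Y * \<beta>)"
  define P' where "P' = mode (- X * (- A * \<alpha>)) (- Y * (Y * \<beta>))"
  define Q' where "Q' = mode (- X * (- X * \<alpha>)) (- Y * (A * \<beta>))"
  define F where "F = (\<lambda>x. Re (\<zeta> * (cnj (P x) * T x + cnj (Q x) * S x)))"
  have T_eq: "T x = \<mu> * (P' x - A * Q x)" for x
    unfolding T_def P'_def Q_def mode_def by (simp add: algebra_simps power2_eq_square)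
  have S_eq: "S x = \<kappa> * Q' x + (\<kappa> - 2 * \<mu>) * A * P x" for x
    unfolding S_def P_def Q'_def mode_def by (simp add: algebra_simps power2_eq_square)
  have T': "(T has_vector_derivative (\<gamma> * lam * P x + A * (2 * \<mu> * A * P x + (\<kappa> - 2 * \<mu>) * (A * P x + Q' x)))) (at x)" for x
  proof -
    \<comment> \<open>Each mode is multiplied by its own form of \<open>\<gamma> lam\<close>, namely
      \<open>\<kappa> (X^2 - A^2)\<close> or \<open>\<mu> (Y^2 - A^2)\<close>; the dispersion
      relations then merge the two into \<open>\<gamma> lam * P x\<close>.\<close>
    have "mode (- X * (\<mu> * (2 * A * X * \<alpha>))) (- Y * (- \<mu> * (Y\<^sup>2 + A\<^sup>2) * \<beta>)) x
      = (\<kappa> * (X\<^sup>2 - A\<^sup>2)) * (- A * \<alpha> * ex (- X) x) + (\<mu> * (Y\<^sup>2 - A\<^sup>2)) * (Y * \<beta> * ex (- Y) x)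
        + A * (2 * \<mu> * A * P x + (\<kappa> - 2 * \<mu>) * (A * P x + Q' x))"
      unfolding P_def Q'_def mode_def by (simp add: algebra_simps power2_eq_square)
    also have "\<dots> = \<gamma> * lam * P x + A * (2 * \<mu> * A * P x + (\<kappa> - 2 * \<mu>) * (A * P x + Q' x))"
      unfolding X[symmetric] Y[symmetric] unfolding P_def mode_def by (simp add: algebra_simps)
    finally show ?thesis unfolding T_def using mode_deriv by metis
  qed
  have S': "(S has_vector_derivative (\<gamma> * lam * Q x - A * T x)) (at x)" for x
  proof -
    have "mode (- X * ((\<kappa> * X\<^sup>2 - (\<kappa> - 2 * \<mu>) * A\<^sup>2) * \<alpha>)) (- Y * (- 2 * \<mu> * A * Y * \<beta>)) x
      = (\<kappa> * (X\<^sup>2 - A\<^sup>2)) * (- X * \<alpha> * ex (- X) x) + (\<mu> * (Y\<^sup>2 - A\<^sup>2)) * (A * \<beta> * ex (- Y) x) - A * T x"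
      unfolding T_def mode_def by (simp add: algebra_simps power2_eq_square)
    also have "\<dots> = \<gamma> * lam * Q x - A * T x"
      unfolding X[symmetric] Y[symmetric] unfolding Q_def mode_def by (simp add: algebra_simps)
    finally show ?thesis unfolding S_def using mode_deriv by metis
  qed
  have PQ': "(P has_vector_derivative P' x) (at x)" "(Q has_vector_derivative Q' x) (at x)" for x
    unfolding P_def Q_def P'_def Q'_def by (rule mode_deriv)+
  have "\<exists>y. (F has_real_derivative y) (at x) \<and> y \<ge> 0" for x
  proof -
    let ?y = "Re (\<zeta> * (\<gamma> * lam * (of_real ((cmod (P x))\<^sup>2 + (cmod (Q x))\<^sup>2)) + of_real (\<mu> * (cmod (P' x - A * Q x))\<^sup>2 + \<mu> * (cmod (A * P x - Q' x))\<^sup>2)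
       + (\<kappa> - \<mu>) * of_real ((cmod (A * P x + Q' x))\<^sup>2)))"
    have "(F has_real_derivative ?y) (at x)"
      unfolding F_def using flux_has_derivative[OF PQ' T' S', of \<zeta> x]
      unfolding gas_flux_identity[OF T_eq S_eq] .
    moreover have "?y = \<gamma> * ((cmod (P x))\<^sup>2 + (cmod (Q x))\<^sup>2) * Re (\<zeta> * lam)
       + (\<mu> * (cmod (P' x - A * Q x))\<^sup>2 + \<mu> * (cmod (A * P x - Q' x))\<^sup>2) * Re \<zeta>
       + (cmod (A * P x + Q' x))\<^sup>2 * Re (\<zeta> * (\<kappa> - \<mu>))"
      by (simp add: algebra_simps)
    moreover have "\<dots> \<ge> 0" using \<zeta> pos by (intro add_nonneg_nonneg mult_nonneg_nonneg) auto
    ultimately show ?thesis by metis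
  qed
  then have mono: "F x \<le> F y" if "x \<le> y" for x y
    using that by (rule_tac DERIV_nonneg_imp_nondecreasing) auto
  have "((\<lambda>x. \<zeta> * (cnj (P x) * T x + cnj (Q x) * S x)) \<longlongrightarrow> \<zeta> * (cnj 0 * 0 + cnj 0 * 0)) at_top"
    unfolding P_def Q_def T_def S_def by (intro tendsto_intros mode_lim)
  then have "(F \<longlongrightarrow> Re (\<zeta> * (cnj 0 * 0 + cnj 0 * 0))) at_top"
    unfolding F_def by (rule tendsto_Re)
  then have "F 0 \<le> 0"
    by (intro tendsto_lowerbound[of F _ at_top]) (auto intro!: eventually_at_top_linorderI[of 0] mono)
  moreover have "P 0 = p" "Q 0 = q" "T 0 = \<tau>" "S 0 = \<sigma>"
    unfolding P_def Q_def T_def S_def mode_def ex_def p q t s by (simp_all add: algebra_simps)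
  ultimately show ?thesis unfolding F_def by simp
qed

lemma exp_mode_tendsto_at_bot:
  fixes k a :: complex
  assumes "Re k > 0"
  shows "((\<lambda>x. a * exp (k * of_real x)) \<longlongrightarrow> 0) at_bot"
  using exp_mode_tendsto[of "- k" a] assms by (simp add: filterlim_at_bot_mirror)

text \<open>The first alternative of \<open>bottom\<close> is the liquid half space, the second the no-slip layer.\<close>

lemma liquid_velocity_zero:
  fixes \<alpha> \<beta> \<alpha>' \<beta>' Z lam \<zeta> :: complex and \<mu> \<gamma> A b :: real
  assumes Z: "\<gamma> * lam = \<mu> * (Z\<^sup>2 - A\<^sup>2)" and re: "Re Z > 0" "A > 0" and pos: "\<mu> > 0" "\<gamma> > 0" "b > 0"
    and \<zeta>: "Re \<zeta> > 0" "Re (\<zeta> * lam) \<ge> 0"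
    and bottom: "\<alpha>' = 0 \<and> \<beta>' = 0 \<or>
       - A * \<alpha> * exp (- A * b) + Z * \<beta> * exp (- Z * b) + A * \<alpha>' * exp (A * b) - Z * \<beta>' * exp (Z * b) = 0 \<and>
       A * \<alpha> * exp (- A * b) - A * \<beta> * exp (- Z * b) + A * \<alpha>' * exp (A * b) - A * \<beta>' * exp (Z * b) = 0"
    and p: "p = - A * \<alpha> + Z * \<beta> + A * \<alpha>' - Z * \<beta>'"
    and q: "q = A * \<alpha> - A * \<beta> + A * \<alpha>' - A * \<beta>'"
    and t: "\<tau> = \<mu> * (- 2 * A\<^sup>2 * \<alpha> + (Z\<^sup>2 + A\<^sup>2) * \<beta> - 2 * A\<^sup>2 * \<alpha>' + (Z\<^sup>2 + A\<^sup>2) * \<beta>')"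
    and s: "\<sigma> = \<mu> * ((Z\<^sup>2 + A\<^sup>2) * \<alpha> - 2 * A * Z * \<beta> - (Z\<^sup>2 + A\<^sup>2) * \<alpha>' + 2 * A * Z * \<beta>')"
    and flux: "Re (\<zeta> * (cnj p * \<tau> + cnj q * \<sigma>)) \<le> 0"
  shows "p = 0" "q = 0"
proof -
  define ex where "ex = (\<lambda>(k::complex) (x::real). exp (k * of_real x))"
  \<comment> \<open>\<alpha>, \<alpha>' are the amplitudes of the pressure modes and \<beta>,
    \<beta>' those of the viscous modes; unprimed modes decay downwards, primed ones
    upwards.\<close>
  define mode where "mode = (\<lambda>(a::complex) (c::complex) (a'::complex) (c'::complex) x. a * ex A x + c * ex Z x + a' * ex (- A) x + c' * ex (- Z) x)"
  have mode_deriv: "(mode a c a' c' has_vector_derivative mode (A * a) (Z * c) (- A * a') (- Z * c') x) (at x)" for a c a' c' :: complex and x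
    unfolding mode_def ex_def
    by (rule has_vector_derivative_eq_rhs, (rule has_vector_derivative_add exp_mode_has_derivative)+) simp
  define P where "P = mode (- A * \<alpha>) (Z * \<beta>) (A * \<alpha>') (- Z * \<beta>')"
  define Q where "Q = mode (A * \<alpha>) (- A * \<beta>) (A * \<alpha>') (- A * \<beta>')"
  define T where "T = mode (- \<mu> * 2 * A\<^sup>2 * \<alpha>) (\<mu> * (Z\<^sup>2 + A\<^sup>2) * \<beta>) (- \<mu> * 2 * A\<^sup>2 * \<alpha>') (\<mu> * (Z\<^sup>2 + A\<^sup>2) * \<beta>')"
  define S where "S = mode (\<mu> * (Z\<^sup>2 + A\<^sup>2) * \<alpha>) (- \<mu> * 2 * A * Z * \<beta>) (- \<mu> * (Z\<^sup>2 + A\<^sup>2) * \<alpha>') (\<mu> * 2 * A * Z * \<beta>')"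
  define F where "F = (\<lambda>x. Re (\<zeta> * (cnj (P x) * T x + cnj (Q x) * S x)))"
  have P': "(P has_vector_derivative (T x / \<mu> + A * Q x)) (at x)" for x
  proof -
    have "T x / \<mu> + A * Q x = mode (A * (- A * \<alpha>)) (Z * (Z * \<beta>)) (- A * (A * \<alpha>')) (- Z * (- Z * \<beta>')) x"
      unfolding T_def Q_def mode_def using pos by (simp add: field_simps power2_eq_square)
    then show ?thesis unfolding P_def using mode_deriv by metis
  qed
  have Q': "(Q has_vector_derivative (- A * P x)) (at x)" for x
  proof -
    have "- A * P x = mode (A * (A * \<alpha>)) (Z * (- A * \<beta>)) (- A * (A * \<alpha>')) (- Z * (- A * \<beta>')) x"
      unfolding P_def mode_def by (simp add: algebra_simps)
    then show ?thesis unfolding Q_def using mode_deriv by metis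
  qed
  have T': "(T has_vector_derivative ((\<gamma> * lam + 4 * \<mu> * A\<^sup>2) * P x + A * S x)) (at x)" for x
  proof -
    have "(\<gamma> * lam + 4 * \<mu> * A\<^sup>2) * P x + A * S x
       = mode (A * (- \<mu> * 2 * A\<^sup>2 * \<alpha>)) (Z * (\<mu> * (Z\<^sup>2 + A\<^sup>2) * \<beta>)) (- A * (- \<mu> * 2 * A\<^sup>2 * \<alpha>')) (- Z * (\<mu> * (Z\<^sup>2 + A\<^sup>2) * \<beta>')) x"
      unfolding Z P_def S_def mode_def by (simp add: algebra_simps power2_eq_square)
    then show ?thesis unfolding T_def using mode_deriv by metis
  qed
  have S': "(S has_vector_derivative (\<gamma> * lam * Q x - A * T x)) (at x)" for x
  proof -
    have "\<gamma> * lam * Q x - A * T x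
       = mode (A * (\<mu> * (Z\<^sup>2 + A\<^sup>2) * \<alpha>)) (Z * (- \<mu> * 2 * A * Z * \<beta>)) (- A * (- \<mu> * (Z\<^sup>2 + A\<^sup>2) * \<alpha>')) (- Z * (\<mu> * 2 * A * Z * \<beta>')) x"
      unfolding Z Q_def T_def mode_def by (simp add: algebra_simps power2_eq_square)
    then show ?thesis unfolding S_def using mode_deriv by metis
  qed
  define F' where "F' = (\<lambda>x. \<gamma> * ((cmod (P x))\<^sup>2 + (cmod (Q x))\<^sup>2) * Re (\<zeta> * lam)
       + (4 * \<mu> * A\<^sup>2 * (cmod (P x))\<^sup>2 + (cmod (T x))\<^sup>2 / \<mu>) * Re \<zeta>)"
  have F': "(F has_real_derivative F' x) (at x)" for x
  proof -
    have "(F has_real_derivative Re (\<zeta> * (\<gamma> * lam * (of_real ((cmod (P x))\<^sup>2 + (cmod (Q x))\<^sup>2))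
        + of_real (4 * \<mu> * A\<^sup>2 * (cmod (P x))\<^sup>2 + (cmod (T x))\<^sup>2 / \<mu>)))) (at x)"
      unfolding F_def using flux_has_derivative[OF P' Q' T' S', of \<zeta> x]
      unfolding liquid_flux_identity[OF less_imp_neq[OF pos(1), symmetric]] .
    then show ?thesis unfolding F'_def by (rule DERIV_cong) (simp add: algebra_simps)
  qed
  have F'_nonneg: "F' x \<ge> 0" for x
    unfolding F'_def using \<zeta> pos by (intro add_nonneg_nonneg mult_nonneg_nonneg) auto
  have mono: "F x \<le> F y" if "x \<le> y" for x y
    using that F' F'_nonneg by (rule_tac DERIV_nonneg_imp_nondecreasing) auto
  have at0: "P 0 = p" "Q 0 = q" "T 0 = \<tau>" "S 0 = \<sigma>"
    unfolding P_def Q_def T_def S_def mode_def ex_def p q t s by (simp_all add: algebra_simps)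
  then have F0: "F 0 \<le> 0" using flux unfolding F_def by simp
  have F_lower: "F x \<ge> 0" if "x > - b" for x
    using bottom
  proof
    assume z: "\<alpha>' = 0 \<and> \<beta>' = 0"
    have mode_lim: "(mode a c 0 0 \<longlongrightarrow> 0) at_bot" for a c
      unfolding mode_def ex_def
      using tendsto_add[OF exp_mode_tendsto_at_bot exp_mode_tendsto_at_bot, of "A" "Z" a c] re by simp
    have "((\<lambda>x. \<zeta> * (cnj (P x) * T x + cnj (Q x) * S x)) \<longlongrightarrow> \<zeta> * (cnj 0 * 0 + cnj 0 * 0)) at_bot"
      unfolding P_def Q_def T_def S_def using z by (intro tendsto_intros) (simp_all add: mode_lim)
    then have "(F \<longlongrightarrow> Re (\<zeta> * (cnj 0 * 0 + cnj 0 * 0))) at_bot"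
      unfolding F_def by (rule tendsto_Re)
    then show ?thesis
      by (intro tendsto_upperbound[of F _ at_bot]) (auto intro!: eventually_at_bot_linorderI[of x] mono)
  next
    assume z: "- A * \<alpha> * exp (- A * b) + Z * \<beta> * exp (- Z * b) + A * \<alpha>' * exp (A * b) - Z * \<beta>' * exp (Z * b) = 0 \<and>
       A * \<alpha> * exp (- A * b) - A * \<beta> * exp (- Z * b) + A * \<alpha>' * exp (A * b) - A * \<beta>' * exp (Z * b) = 0"
    then have "P (- b) = 0" "Q (- b) = 0"
      unfolding P_def Q_def mode_def ex_def by (simp_all flip: exp_of_real)
    then have "F (- b) = 0" by (simp add: F_def)
    then show ?thesis using mono[of "- b" x] that by simp
  qed
  have F_zero: "F x = 0" if "- b < x" "x < 0" for x
    using F_lower[of x] mono[of x 0] F0 that by simp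
  have F'_zero: "F' x = 0" if x: "- b < x" "x < 0" for x
  proof -
    have "((\<lambda>x. 0) has_real_derivative F' x) (at x)"
      by (rule has_field_derivative_transform_within_open[OF F', of "{- b<..<0}"]) (use x F_zero in auto)
    then show ?thesis using DERIV_unique DERIV_const by metis
  qed
  \<comment> \<open>\<open>Re (\<zeta> * lam)\<close> may be 0, so the kinetic term yields nothing.
    The dissipation gives \<open>P\<close> and \<open>T\<close>; \<open>Q\<close> then follows from
    the equation for the derivative of \<open>P\<close>, since \<open>A > 0\<close>.\<close>
  have PT_zero: "P x = 0 \<and> T x = 0" if x: "- b < x" "x < 0" for x
  proof -
    have "0 \<le> \<gamma> * ((cmod (P x))\<^sup>2 + (cmod (Q x))\<^sup>2) * Re (\<zeta> * lam)"
      using \<zeta> pos by simp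
    then have "(4 * \<mu> * A\<^sup>2 * (cmod (P x))\<^sup>2 + (cmod (T x))\<^sup>2 / \<mu>) * Re \<zeta> \<le> 0"
      using F'_zero[OF x] unfolding F'_def by linarith
    then have "4 * \<mu> * A\<^sup>2 * (cmod (P x))\<^sup>2 + (cmod (T x))\<^sup>2 / \<mu> \<le> 0"
      using \<zeta> by (simp add: mult_le_0_iff)
    moreover have "4 * \<mu> * A\<^sup>2 * (cmod (P x))\<^sup>2 \<ge> 0" "(cmod (T x))\<^sup>2 / \<mu> \<ge> 0" using pos by simp_all
    ultimately have "4 * \<mu> * A\<^sup>2 * (cmod (P x))\<^sup>2 = 0" "(cmod (T x))\<^sup>2 / \<mu> = 0" by linarith+
    then show ?thesis using pos re by simp
  qed
  have Q_zero: "Q x = 0" if x: "- b < x" "x < 0" for x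
  proof -
    have "((\<lambda>x. 0) has_vector_derivative (T x / \<mu> + A * Q x)) (at x)"
      by (rule has_vector_derivative_transform_within_open[OF P', of "{- b<..<0}"]) (use x PT_zero in auto)
    then have "T x / \<mu> + A * Q x = 0"
      using vector_derivative_unique_at has_vector_derivative_const by metis
    then show ?thesis using PT_zero[OF x] re by simp
  qed
  \<comment> \<open>The flux is known to vanish only inside the layer; the values at the interface
    follow by continuity.\<close>
  have limit: "f 0 = 0" if "\<And>x. - b < x \<Longrightarrow> x < 0 \<Longrightarrow> f x = 0" "isCont f 0" for f :: "real \<Rightarrow> complex"
  proof (rule tendsto_unique)
    show "(f \<longlongrightarrow> f 0) (at_left 0)" using that(2) by (simp add: isCont_def filterlim_at_split)
    show "(f \<longlongrightarrow> 0) (at_left 0)"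
      by (rule tendsto_eventually) (use that(1) pos in \<open>auto simp: eventually_at_left_field intro: exI[of _ "- b"]\<close>)
  qed simp
  show "p = 0" "q = 0"
    using limit[of P] limit[of Q] PT_zero Q_zero at0 P' Q' has_vector_derivative_continuous by metis+
qed

section \<open>Nonvanishing of the determinant at positive frequency\<close>

lemma symbol_det_nonzero_energy:
  fixes A \<mu>p \<mu>m \<nu>p \<gamma>p \<gamma>m :: real and \<zeta> lam \<delta> X Y Z g h E e M :: complex
  assumes pos: "\<mu>p > 0" "\<mu>m > 0" "\<gamma>p > 0" "\<gamma>m > 0" "A > 0" and lam: "lam \<noteq> 0"
    and \<zeta>: "Re \<zeta> > 0" "Re (\<zeta> * lam) \<ge> 0" "Re (\<zeta> * (\<nu>p + \<delta>)) \<ge> 0"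
    and X: "\<gamma>p * lam = (\<mu>p + \<nu>p + \<delta>) * (X\<^sup>2 - A\<^sup>2)"
    and Y: "\<gamma>p * lam = \<mu>p * (Y\<^sup>2 - A\<^sup>2)" and Z: "\<gamma>m * lam = \<mu>m * (Z\<^sup>2 - A\<^sup>2)"
    and re: "Re X > 0" "Re Y > 0" "Re Z > 0"
    and nz: "X * Y - A\<^sup>2 \<noteq> 0"
    and g: "g = (Y\<^sup>2 - A\<^sup>2) / (X * Y - A\<^sup>2)" and h: "h = (X\<^sup>2 - A\<^sup>2) / (X * Y - A\<^sup>2)"
    and EeM: "E = exp (- Z * b) \<and> e = exp (- A * b) \<and> M = (E - e) / (Z - A) \<and> b > 0 \<or> E = 0 \<and> e = 0 \<and> M = 0"
  shows "symbol_det \<mu>p \<mu>m \<nu>p \<delta> A X Y Z g h E e M \<noteq> 0"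
proof
  assume "symbol_det \<mu>p \<mu>m \<nu>p \<delta> A X Y Z g h E e M = 0"
  then obtain c1 c2 d1 d2 p q where c: "c1 \<noteq> 0 \<or> c2 \<noteq> 0"
    and d1: "d1 = c1 * E + A * M * (c1 + Z * c2)" and d2: "d2 = c2 * E - M * (c1 + Z * c2)"
    and p: "p = c1 - d1 * E - A * M * (d1 - Z * d2)" and q: "q = A * (c2 - d2 * E - M * (d1 - Z * d2))"
    and r1: "- \<mu>p * X * g * p - \<mu>p * (complex_of_real A) * (2 - g) * q =
       \<mu>m * (((complex_of_real A) + Z) * c1 + (Z - (complex_of_real A)) * (complex_of_real A) * c2) + \<mu>m * (((complex_of_real A) + Z) * E + 2 * (complex_of_real A)\<^sup>2 * M) * d1
       - \<mu>m * (2 * (complex_of_real A)\<^sup>2 * Z * M + (Z - (complex_of_real A)) * (complex_of_real A) * E) * d2"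
    and r2: "- (complex_of_real A) * (2 * \<mu>p * (X * ((g - h) / (X + Y))) - (\<nu>p - \<mu>p + \<delta>) * h) * p - (\<mu>p + \<nu>p + \<delta>) * Y * h * q =
       \<mu>m * ((Z - (complex_of_real A)) * c1 + ((complex_of_real A) + Z) * Z * c2) + \<mu>m * (2 * (complex_of_real A) * Z * M - (Z - (complex_of_real A)) * e) * d1
       + \<mu>m * (- 2 * (complex_of_real A)\<^sup>2 * Z * M + (Z + (complex_of_real A)) * Z * e) * d2"
    by (rule symbol_det_kernel)
  \<comment> \<open>For nonzero \<lambda> the exponents \<open>A\<close> and \<open>Z\<close>
    differ, so the coefficients can be converted into amplitudes of the pressure and viscous
    modes.\<close>
  have "\<mu>m * (Z\<^sup>2 - A\<^sup>2) \<noteq> 0" using lam pos Z by (metis mult_eq_0_iff of_real_eq_0_iff less_irrefl)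
  then have ZA: "Z - A \<noteq> 0" by auto
  have ZA': "A + Z \<noteq> 0" "Z \<noteq> 0" using re pos by (auto simp: complex_eq_iff)
  have XY: "X + Y \<noteq> 0" using re by (auto simp: complex_eq_iff)
  have eM: "e = E - (Z - A) * M" using EeM ZA by auto

  define W where "W = X * Y - A\<^sup>2"
  \<comment> \<open>Cramer's rule for the amplitudes of the two gas modes with interface velocity
    \<open>(p, q)\<close>; \<open>W\<close> is the determinant of that system.\<close>
  define \<alpha> where "\<alpha> = (A * p - Y * q) / W"
  define \<beta> where "\<beta> = (X * p - A * q) / W"
  define \<tau> where "\<tau> = - \<mu>p * X * g * p - \<mu>p * A * (2 - g) * q"
  define \<sigma> where "\<sigma> = - A * (2 * \<mu>p * (X * ((g - h) / (X + Y))) - (\<nu>p - \<mu>p + \<delta>) * h) * p - (\<mu>p + \<nu>p + \<delta>) * Y * h * q"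
  have \<tau>r1: "\<tau> = - \<mu>p * X * g * p - \<mu>p * (complex_of_real A) * (2 - g) * q" and \<sigma>r2: "\<sigma> = - (complex_of_real A) * (2 * \<mu>p * (X * ((g - h) / (X + Y))) - (\<nu>p - \<mu>p + \<delta>) * h) * p - (\<mu>p + \<nu>p + \<delta>) * Y * h * q"
    by (simp_all add: \<tau>_def \<sigma>_def)
  have gh: "(g - h) / (X + Y) = (Y - X) / W"
    using nz XY unfolding g h W_def by (simp add: divide_simps) (simp add: algebra_simps power2_eq_square)
  have W: "W \<noteq> 0" using nz by (simp add: W_def)
  have W\<alpha>\<beta>: "A * p - Y * q = W * \<alpha>" "X * p - A * q = W * \<beta>"
    using W by (simp_all add: \<alpha>_def \<beta>_def)
  have flux: "Re (\<zeta> * (cnj p * \<tau> + cnj q * \<sigma>)) \<le> 0"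
  proof (rule gas_flux_nonpos[OF X Y re(1,2) pos(1) pos(3) less_imp_le[OF \<zeta>(1)] \<zeta>(2), where \<alpha> = \<alpha> and \<beta> = \<beta>])
    show "Re (\<zeta> * (\<mu>p + \<nu>p + \<delta> - \<mu>p)) \<ge> 0" using \<zeta>(3) by (simp add: algebra_simps)
    have "W * p = - A * (A * p - Y * q) + Y * (X * p - A * q)" "W * q = - X * (A * p - Y * q) + A * (X * p - A * q)"
      by (simp_all add: W_def algebra_simps power2_eq_square)
    then show "p = - A * \<alpha> + Y * \<beta>" "q = - X * \<alpha> + A * \<beta>"
      using W unfolding \<alpha>_def \<beta>_def by (simp_all add: field_simps)
    have "W * \<tau> = - \<mu>p * X * (Y\<^sup>2 - A\<^sup>2) * p - \<mu>p * A * (2 * W - (Y\<^sup>2 - A\<^sup>2)) * q"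
      using W unfolding \<tau>_def g W_def[symmetric] by (simp add: field_simps)
    also have "\<dots> = \<mu>p * (2 * A * X * (A * p - Y * q) - (Y\<^sup>2 + A\<^sup>2) * (X * p - A * q))"
      by (simp add: W_def algebra_simps power2_eq_square)
    also have "\<dots> = W * (\<mu>p * (2 * A * X * \<alpha> - (Y\<^sup>2 + A\<^sup>2) * \<beta>))"
      unfolding W\<alpha>\<beta> by (simp add: algebra_simps)
    finally show "\<tau> = \<mu>p * (2 * A * X * \<alpha> - (Y\<^sup>2 + A\<^sup>2) * \<beta>)"
      using W by simp
    have "W * \<sigma> = - A * (2 * \<mu>p * (X * (Y - X)) - (\<nu>p - \<mu>p + \<delta>) * (X\<^sup>2 - A\<^sup>2)) * p - (\<mu>p + \<nu>p + \<delta>) * Y * (X\<^sup>2 - A\<^sup>2) * q"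
      using W unfolding \<sigma>_def gh unfolding h W_def[symmetric] by (simp add: field_simps)
    also have "\<dots> = ((\<mu>p + \<nu>p + \<delta>) * X\<^sup>2 - (\<mu>p + \<nu>p + \<delta> - 2 * \<mu>p) * A\<^sup>2) * (A * p - Y * q) - 2 * \<mu>p * A * Y * (X * p - A * q)"
      by (simp add: algebra_simps power2_eq_square)
    also have "\<dots> = W * (((\<mu>p + \<nu>p + \<delta>) * X\<^sup>2 - (\<mu>p + \<nu>p + \<delta> - 2 * \<mu>p) * A\<^sup>2) * \<alpha> - 2 * \<mu>p * A * Y * \<beta>)"
      unfolding W\<alpha>\<beta> by (simp add: algebra_simps)
    finally show "\<sigma> = ((\<mu>p + \<nu>p + \<delta>) * X\<^sup>2 - (\<mu>p + \<nu>p + \<delta> - 2 * \<mu>p) * A\<^sup>2) * \<alpha> - 2 * \<mu>p * A * Y * \<beta>"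
      using W by simp
  qed

  \<comment> \<open>\<open>a\<close>, \<open>k\<close> are the amplitudes at the interface of the
    modes decaying downwards. \<open>a'\<close>, \<open>k'\<close> are normalised at the bottom, so
    at the interface they appear with the factors \<open>e\<close> and \<open>E\<close> and
    disappear for the half space.\<close>
  define a where "a = (c1 + Z * c2) / (Z - A)"
  define k where "k = (c1 + A * c2) / (Z - A)"
  define a' where "a' = (d1 - Z * d2) / (Z - A)"
  define k' where "k' = (d1 - A * d2) / (Z - A)"
  define m where "m = E - e"
  have m: "(Z - A) * M = m" "e = E - m" using eM by (simp_all add: m_def)
  have c12: "c1 = Z * k - A * a" "c2 = a - k" and cZ: "c1 + Z * c2 = (Z - A) * a"
    using ZA unfolding a_def k_def by (simp_all add: divide_simps) (simp_all add: algebra_simps)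
  have d12: "d1 = Z * k' - A * a'" "d2 = k' - a'" and dZ: "d1 - Z * d2 = (Z - A) * a'"
    using ZA unfolding a'_def k'_def by (simp_all add: divide_simps) (simp_all add: algebra_simps)
  have Ma: "M * (c1 + Z * c2) = m * a" "M * (d1 - Z * d2) = m * a'"
    unfolding cZ dZ m(1)[symmetric] by simp_all
  have d1': "d1 = c1 * E + A * (m * a)" and d2': "d2 = c2 * E - m * a"
    using d1 d2 Ma by (simp_all add: mult.assoc)
  have p': "p = - A * a + Z * k + A * (a' * e) - Z * (k' * E)"
  proof -
    have "p = c1 - d1 * E - A * (M * (d1 - Z * d2))" using p by (simp add: mult.assoc)
    then show ?thesis unfolding Ma unfolding c12 d12 m(2) by (simp add: algebra_simps)
  qed
  have q': "q = A * a - A * k + A * (a' * e) - A * (k' * E)"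
    unfolding q Ma unfolding c12 d12 m(2) by (simp add: algebra_simps)
  have t': "\<tau> = \<mu>m * (- 2 * A\<^sup>2 * a + (Z\<^sup>2 + A\<^sup>2) * k - 2 * A\<^sup>2 * (a' * e) + (Z\<^sup>2 + A\<^sup>2) * (k' * E))"
  proof -
    have "\<tau> = \<mu>m * ((A + Z) * c1 + (Z - A) * A * c2) + \<mu>m * (A + Z) * E * d1 - \<mu>m * (Z - A) * A * E * d2
        + \<mu>m * 2 * A\<^sup>2 * (M * (d1 - Z * d2))"
      unfolding \<tau>r1 r1 by (simp add: algebra_simps)
    then show ?thesis unfolding Ma unfolding c12 d12 m(2) by (simp add: algebra_simps power2_eq_square)
  qed
  have s': "\<sigma> = \<mu>m * ((Z\<^sup>2 + A\<^sup>2) * a - 2 * A * Z * k - (Z\<^sup>2 + A\<^sup>2) * (a' * e) + 2 * A * Z * (k' * E))"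
  proof -
    have "\<sigma> = \<mu>m * ((Z - A) * c1 + (A + Z) * Z * c2) - \<mu>m * (Z - A) * e * d1
       + \<mu>m * (Z + A) * Z * e * d2 + \<mu>m * 2 * A * Z * (M * (d1 - A * d2))"
      unfolding \<sigma>r2 r2 by (simp add: algebra_simps power2_eq_square)
    moreover have Mk: "M * (d1 - A * d2) = m * k'" using ZA unfolding k'_def m(1)[symmetric] by simp
    ultimately show ?thesis unfolding Mk unfolding c12 d12 m(2) by (simp add: algebra_simps power2_eq_square)
  qed
  \<comment> \<open>In the half-space alternative \<open>b\<close> is arbitrary; the value 1 only
    supplies the positive depth that \<open>liquid_velocity_zero\<close> asks for.\<close>
  define b' where "b' = (if b > 0 then b else 1)"
  have "p = 0" "q = 0"
  proof (atomize (full), intro conjI, goal_cases)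
    have bottom: "a' * e = 0 \<and> k' * E = 0 \<or>
       - A * a * exp (- A * b') + Z * k * exp (- Z * b') + A * (a' * e) * exp (A * b') - Z * (k' * E) * exp (Z * b') = 0 \<and>
       A * a * exp (- A * b') - A * k * exp (- Z * b') + A * (a' * e) * exp (A * b') - A * (k' * E) * exp (Z * b') = 0"
      using EeM
    proof
      assume Ee: "E = exp (- Z * b) \<and> e = exp (- A * b) \<and> M = (E - e) / (Z - A) \<and> b > 0"
      then have b': "b' = b" by (simp add: b'_def)
      have 1: "exp (- A * b') = e" "exp (- Z * b') = E" using Ee b' by simp_all
      have 2: "e * exp (A * b') = 1" "E * exp (Z * b') = 1"
        using Ee b' by (simp_all flip: exp_add exp_of_real)
      have 3: "A * (a' * e) * exp (A * b') = A * a'" "Z * (k' * E) * exp (Z * b') = Z * k'"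
         "A * (k' * E) * exp (Z * b') = A * k'"
        using 2 by (simp_all add: mult.assoc)
      have "- A * a * e + Z * k * E + A * a' - Z * k' = - A * a * e + Z * k * E - d1"
        unfolding d12 by simp
      also have "\<dots> = 0" unfolding d1' c12 m(2) by (simp add: algebra_simps)
      finally have 4: "- A * a * e + Z * k * E + A * a' - Z * k' = 0" .
      have "A * a * e - A * k * E + A * a' - A * k' = A * a * e - A * k * E - A * d2"
        unfolding d12 by (simp add: algebra_simps)
      also have "\<dots> = 0" unfolding d2' c12 m(2) by (simp add: algebra_simps)
      finally have 5: "A * a * e - A * k * E + A * a' - A * k' = 0" .
      show ?thesis unfolding 3 1 using 4 5 by simp
    qed simp
    have b': "b' > 0" by (simp add: b'_def)
    note v = liquid_velocity_zero[OF Z re(3) pos(5) pos(2) pos(4) b' \<zeta>(1,2) bottom p' q' t' s' flux]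
    { case 1 show ?case by (rule v(1)) next case 2 show ?case by (rule v(2)) }
  qed
  then have "c1 - d1 * E - A * M * (d1 - Z * d2) = 0" "c2 - d2 * E - M * (d1 - Z * d2) = 0"
    using p q pos by simp_all
  moreover have "\<tau> = 0" "\<sigma> = 0" using \<open>p = 0\<close> \<open>q = 0\<close> by (simp_all add: \<tau>_def \<sigma>_def)
  ultimately have "c1 = 0 \<and> c2 = 0"
    using r1[folded \<tau>r1] r2[folded \<sigma>r2] pos ZA'
    by (intro liquid_data_determine_coefficients[OF d1 d2 _ _ eM, of \<mu>m]) simp_all
  with c show False by blast
qed

section \<open>Rotations of the resolvent parameter\<close>

text \<open>\<open>|Arg z|\<close> lies between \<open>pi / 2\<close> and
  \<open>pi - \<epsilon>\<close>, where the sine decreases to \<open>sin \<epsilon>\<close>.\<close>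

lemma Im_sector_bound:
  assumes "z \<in> Sigma_sector \<epsilon>" "Re z < 0" "0 < \<epsilon>" "\<epsilon> < pi / 2"
  shows "\<bar>Im z\<bar> \<ge> cmod z * sin \<epsilon>"
proof -
  define \<theta> where "\<theta> = \<bar>Arg z\<bar>"
  have z: "z \<noteq> 0" and le: "\<theta> \<le> pi - \<epsilon>" using assms by (auto simp: Sigma_sector_def \<theta>_def)
  have z_eq: "z = rcis (cmod z) (Arg z)" by (simp add: rcis_cmod_Arg)
  have re: "Re z = cmod z * cos (Arg z)" and im: "Im z = cmod z * sin (Arg z)"
    by (subst z_eq, simp)+
  have "cos (Arg z) = cos \<theta>" by (simp add: \<theta>_def abs_if)
  then have "cos \<theta> < 0" using re assms(2) z by (simp add: mult_less_0_iff)
  then have "\<not> \<theta> \<le> pi / 2" using cos_ge_zero[of \<theta>] pi_gt_zero abs_ge_zero[of "Arg z"]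
    unfolding \<theta>_def by linarith
  then have "sin \<epsilon> \<le> sin (pi - \<theta>)"
    using le assms by (intro sin_monotone_2pi_le) auto
  then have "sin \<epsilon> \<le> sin \<theta>" by simp
  also have "\<dots> \<le> \<bar>sin (Arg z)\<bar>" by (auto simp: \<theta>_def abs_if)
  finally show ?thesis unfolding im by (simp add: abs_mult mult_left_mono)
qed

text \<open>All conditions are closed, with a uniform \<open>c\<close>, and unaffected by a positive
  rescaling of \<open>lam\<close>, so they pass to limits of rescaled parameters; unit modulus
  confines \<zeta> to a compact set.\<close>

definition rotated :: "real \<Rightarrow> real \<Rightarrow> complex \<Rightarrow> complex \<Rightarrow> complex \<Rightarrow> bool" where
  "rotated \<nu>p c lam \<delta> \<zeta> \<longleftrightarrow>
     cmod \<zeta> = 1 \<and> c \<le> Re \<zeta> \<and> 0 \<le> Re (\<zeta> * lam) \<and> c \<le> Re (\<zeta> * (\<nu>p + \<delta>))"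

text \<open>\<zeta> is \<open>\<i> * sgn (Im w) * cnj w / cmod w\<close>; the sign selects, among
  the two unit numbers turning \<open>w\<close> onto the axis, the one with positive real
  part.\<close>

lemma rotation_turning_to_imaginary_axis:
  assumes "Im w \<noteq> 0"
  obtains \<zeta> where "cmod \<zeta> = 1" "Re \<zeta> = \<bar>Im w\<bar> / cmod w" "Im \<zeta> = sgn (Im w) * Re w / cmod w"
    "Re (\<zeta> * w) = 0"
proof
  let ?\<zeta> = "Complex (\<bar>Im w\<bar> / cmod w) (sgn (Im w) * Re w / cmod w)"
  have w: "cmod w > 0" using assms by auto
  have "(\<bar>Im w\<bar> / cmod w)\<^sup>2 + (sgn (Im w) * Re w / cmod w)\<^sup>2 = ((Re w)\<^sup>2 + (Im w)\<^sup>2) / (cmod w)\<^sup>2"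
    using assms by (simp add: power_divide power_mult_distrib add_divide_distrib sgn_real_def)
  also have "\<dots> = 1" using w by (simp flip: cmod_power2)
  finally show "cmod ?\<zeta> = 1" by (simp add: complex_norm)
  show "Re ?\<zeta> = \<bar>Im w\<bar> / cmod w" "Im ?\<zeta> = sgn (Im w) * Re w / cmod w" by simp_all
  show "Re (?\<zeta> * w) = 0" using w by (simp add: field_simps sgn_real_def abs_if)
qed

text \<open>For \<open>Re lam \<ge> 0\<close> also \<open>Re \<delta> \<ge> 0\<close>, and \<zeta> =
  1 works. Otherwise \<open>lam\<close> is turned onto the imaginary axis. With
  \<open>k = \<gamma>1p * \<gamma>2p\<close>, lying outside the disc that \<open>K_region\<close>
  excludes means \<open>- 2 Re lam / |lam|^2 \<le> 1 / (k / \<nu>p + \<epsilon>)\<close>, which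
  leaves the margin \<open>\<nu>p \<epsilon> / (k / \<nu>p + \<epsilon>)\<close> in the viscosity
  condition.\<close>

lemma case_C1_rotated:
  assumes "case_C1 \<gamma>1p \<gamma>2p \<nu>p \<epsilon> lam0 lam \<delta>" and \<epsilon>: "0 < \<epsilon>" "\<epsilon> < pi / 2"
    and pos: "lam0 > 0" "\<nu>p > 0" "\<gamma>1p > 0" "\<gamma>2p > 0"
    and c: "c \<le> 1" "c \<le> \<nu>p" "c \<le> sin \<epsilon>" "c \<le> sin \<epsilon> * (\<nu>p * \<epsilon> / (\<gamma>1p * \<gamma>2p / \<nu>p + \<epsilon>))"
  shows "\<exists>\<zeta>. rotated \<nu>p c lam \<delta> \<zeta>" and "cmod lam \<ge> lam0" and "cmod \<delta> \<le> \<gamma>1p * \<gamma>2p / lam0"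
proof -
  define k where "k = \<gamma>1p * \<gamma>2p"
  have k: "k > 0" using pos by (simp add: k_def)
  have \<delta>: "\<delta> = k / lam" and sec: "lam \<in> Sigma_sector \<epsilon>" and l0: "cmod lam \<ge> lam0"
    and K: "(Re lam + k / \<nu>p + \<epsilon>)\<^sup>2 + (Im lam)\<^sup>2 \<ge> (k / \<nu>p + \<epsilon>)\<^sup>2"
    using assms(1) unfolding case_C1_def Sigma_sector0_def K_region_def k_def by auto
  have lam: "lam \<noteq> 0" "cmod lam > 0" using l0 pos by auto
  show "cmod lam \<ge> lam0" by (rule l0)
  show "cmod \<delta> \<le> \<gamma>1p * \<gamma>2p / lam0"
    unfolding \<delta> k_def[symmetric] using k l0 pos by (simp add: norm_divide frac_le)
  have Re\<delta>: "Re \<delta> = k * Re lam / (cmod lam)\<^sup>2" and Im\<delta>: "Im \<delta> = - k * Im lam / (cmod lam)\<^sup>2"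
    unfolding \<delta> by (simp_all add: Re_divide Im_divide cmod_power2)
  show "\<exists>\<zeta>. rotated \<nu>p c lam \<delta> \<zeta>"
  proof (cases "Re lam \<ge> 0")
    case True
    then have "Re \<delta> \<ge> 0" unfolding Re\<delta> using k by simp
    then show ?thesis using c True by (intro exI[of _ 1]) (simp add: rotated_def)
  next
    case False
    have im: "\<bar>Im lam\<bar> \<ge> cmod lam * sin \<epsilon>" using Im_sector_bound[OF sec _ \<epsilon>] False by simp
    have sin: "sin \<epsilon> > 0" using \<epsilon> by (simp add: sin_gt_zero)
    have s: "\<bar>Im lam\<bar> / cmod lam \<ge> sin \<epsilon>" using im lam by (simp add: field_simps)
    have "Im lam \<noteq> 0" using im lam sin mult_pos_pos[of "cmod lam" "sin \<epsilon>"] by linarith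
    from rotation_turning_to_imaginary_axis[OF this] obtain \<zeta> where
      \<zeta>: "cmod \<zeta> = 1" "Re \<zeta> = \<bar>Im lam\<bar> / cmod lam" "Im \<zeta> = sgn (Im lam) * Re lam / cmod lam" "Re (\<zeta> * lam) = 0" .
    have n2: "(cmod lam)\<^sup>2 > 0" using lam by simp
    have "(cmod lam)\<^sup>2 + 2 * Re lam * (k / \<nu>p + \<epsilon>) \<ge> 0"
      using K unfolding cmod_power2 by (simp add: power2_eq_square algebra_simps)
    then have "- 2 * Re lam / (cmod lam)\<^sup>2 \<le> 1 / (k / \<nu>p + \<epsilon>)"
      using n2 k \<epsilon> pos by (simp add: field_simps add_pos_pos)
    then have "k * (- 2 * Re lam / (cmod lam)\<^sup>2) \<le> k * (1 / (k / \<nu>p + \<epsilon>))"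
      using k by (intro mult_left_mono) auto
    moreover have "\<nu>p - k * (1 / (k / \<nu>p + \<epsilon>)) = \<nu>p * \<epsilon> / (k / \<nu>p + \<epsilon>)"
    proof -
      have "k / \<nu>p + \<epsilon> > 0" using k \<epsilon> pos by (simp add: add_pos_pos)
      then have "\<nu>p - k * (1 / (k / \<nu>p + \<epsilon>)) = (\<nu>p * (k / \<nu>p + \<epsilon>) - k) / (k / \<nu>p + \<epsilon>)"
        by (simp add: diff_divide_distrib)
      then show ?thesis using pos by (simp add: distrib_left)
    qed
    ultimately have lower: "\<nu>p + 2 * k * Re lam / (cmod lam)\<^sup>2 \<ge> \<nu>p * \<epsilon> / (k / \<nu>p + \<epsilon>)"
      by simp
    \<comment> \<open>The factor 2 arises because \<delta> has the phase of \<open>cnj lam\<close>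
      and so has \<zeta>, up to a factor \<open>\<i>\<close> or \<open>- \<i>\<close>: the real part
      of \<open>\<zeta> * \<delta>\<close> involves
      \<open>Im (lam^2) = 2 Re lam Im lam\<close>.\<close>
    have "Re (\<zeta> * (\<nu>p + \<delta>)) = \<bar>Im lam\<bar> / cmod lam * (\<nu>p + 2 * k * Re lam / (cmod lam)\<^sup>2)"
      using lam by (cases "Im lam \<ge> 0") (simp_all add: \<zeta> Re\<delta> Im\<delta> sgn_real_def field_simps)
    also have "\<dots> \<ge> sin \<epsilon> * (\<nu>p * \<epsilon> / (k / \<nu>p + \<epsilon>))"
      using s lower sin \<epsilon> k pos by (intro mult_mono) auto
    finally have "Re (\<zeta> * (\<nu>p + \<delta>)) \<ge> c" using c(4) by (simp add: k_def)
    then show ?thesis using \<zeta>(1,2,4) s c(3) unfolding rotated_def by (intro exI[of _ \<zeta>]) linarith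
  qed
qed

text \<open>Here \<delta> is turned onto the imaginary axis, so only
  \<open>\<nu>p * Re \<zeta>\<close> remains of the viscosity term. The cone prescribed for
  \<open>lam\<close> has the slope that guarantees \<open>Re (\<zeta> * lam) \<ge> 0\<close> for
  either sign of \<open>Im lam\<close>.\<close>

lemma case_C2_rotated:
  assumes "case_C2 \<epsilon> lam0 \<delta>0 lam \<delta>" and \<epsilon>: "0 < \<epsilon>" "\<epsilon> < pi / 2"
    and pos: "\<nu>p > 0" and c: "c \<le> sin \<epsilon>" "c \<le> sin \<epsilon> * \<nu>p"
  shows "\<exists>\<zeta>. rotated \<nu>p c lam \<delta> \<zeta>"
proof -
  have sec: "\<delta> \<in> Sigma_sector \<epsilon>" and re: "Re \<delta> < 0" and lam: "Re lam \<ge> \<bar>Re \<delta> / Im \<delta>\<bar> * \<bar>Im lam\<bar>"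
    using assms(1) unfolding case_C2_def by auto
  have \<delta>: "cmod \<delta> > 0" using re by auto
  have im: "\<bar>Im \<delta>\<bar> \<ge> cmod \<delta> * sin \<epsilon>" using Im_sector_bound[OF sec re \<epsilon>] .
  have sin: "sin \<epsilon> > 0" using \<epsilon> by (simp add: sin_gt_zero)
  have s: "\<bar>Im \<delta>\<bar> / cmod \<delta> \<ge> sin \<epsilon>" using im \<delta> by (simp add: field_simps)
  have im0: "Im \<delta> \<noteq> 0" using im \<delta> sin mult_pos_pos[of "cmod \<delta>" "sin \<epsilon>"] by linarith
  from rotation_turning_to_imaginary_axis[OF this] obtain \<zeta> where
    \<zeta>: "cmod \<zeta> = 1" "Re \<zeta> = \<bar>Im \<delta>\<bar> / cmod \<delta>" "Im \<zeta> = sgn (Im \<delta>) * Re \<delta> / cmod \<delta>" "Re (\<zeta> * \<delta>) = 0" .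
  have "Re (\<zeta> * (\<nu>p + \<delta>)) = Re \<zeta> * \<nu>p" using \<zeta>(4) by (simp add: algebra_simps)
  also have "\<dots> \<ge> sin \<epsilon> * \<nu>p" using s pos unfolding \<zeta>(2) by (rule_tac mult_right_mono) auto
  finally have 1: "Re (\<zeta> * (\<nu>p + \<delta>)) \<ge> c" using c by simp
  have "\<bar>Re \<delta>\<bar> * \<bar>Im lam\<bar> \<le> \<bar>Im \<delta>\<bar> * Re lam"
    using lam im0 by (simp add: abs_divide field_simps)
  moreover have "sgn (Im \<delta>) * Re \<delta> * Im lam \<le> \<bar>Re \<delta>\<bar> * \<bar>Im lam\<bar>"
    by (metis abs_ge_self abs_mult abs_sgn_eq_1 im0 mult_1)
  ultimately have "(\<bar>Im \<delta>\<bar> * Re lam - sgn (Im \<delta>) * Re \<delta> * Im lam) / cmod \<delta> \<ge> 0" by simp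
  then have "Re (\<zeta> * lam) \<ge> 0" by (simp add: \<zeta> diff_divide_distrib)
  then show ?thesis using 1 s \<zeta> c by (intro exI[of _ \<zeta>]) (simp add: rotated_def)
qed

lemma case_C3_rotated:
  assumes "case_C3 \<epsilon> lam0 \<delta>0 lam \<delta>" "lam0 > 0" "c \<le> 1" "c \<le> \<nu>p"
  shows "\<exists>\<zeta>. rotated \<nu>p c lam \<delta> \<zeta>"
proof -
  have "0 \<le> lam0 * \<bar>Im lam\<bar>" using assms by simp
  then have "Re lam \<ge> 0" using assms(1) unfolding case_C3_def by linarith
  then show ?thesis using assms by (intro exI[of _ 1]) (simp add: rotated_def case_C3_def)
qed

lemma admissible_rotated:
  assumes \<epsilon>: "0 < \<epsilon>" "\<epsilon> < pi / 2" and pos: "lam0 > 0" "\<nu>p > 0" "\<gamma>1p > 0" "\<gamma>2p > 0"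
  obtains c d where "c > 0"
    "\<And>lam \<delta>. case_C1 \<gamma>1p \<gamma>2p \<nu>p \<epsilon> lam0 lam \<delta> \<or> case_C2 \<epsilon> lam0 \<delta>0 lam \<delta> \<or> case_C3 \<epsilon> lam0 \<delta>0 lam \<delta> \<Longrightarrow>
       (\<exists>\<zeta>. rotated \<nu>p c lam \<delta> \<zeta>) \<and> lam0 \<le> cmod lam \<and> cmod \<delta> \<le> d"
proof
  define c where "c = Min {1, \<nu>p, sin \<epsilon>, sin \<epsilon> * (\<nu>p * \<epsilon> / (\<gamma>1p * \<gamma>2p / \<nu>p + \<epsilon>)), sin \<epsilon> * \<nu>p}"
  \<comment> \<open>\<delta> is bounded by assumption in (C2), (C3), and in (C1) because
    \<open>|lam| \<ge> lam0\<close>.\<close>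
  define d where "d = max \<delta>0 (\<gamma>1p * \<gamma>2p / lam0)"
  have sin: "sin \<epsilon> > 0" using \<epsilon> by (simp add: sin_gt_zero)
  show "c > 0" using sin pos \<epsilon> by (simp add: c_def add_pos_pos)
  have c: "c \<le> 1" "c \<le> \<nu>p" "c \<le> sin \<epsilon>" "c \<le> sin \<epsilon> * (\<nu>p * \<epsilon> / (\<gamma>1p * \<gamma>2p / \<nu>p + \<epsilon>))" "c \<le> sin \<epsilon> * \<nu>p"
    unfolding c_def by (intro Min_le; simp)+
  fix lam \<delta>
  assume "case_C1 \<gamma>1p \<gamma>2p \<nu>p \<epsilon> lam0 lam \<delta> \<or> case_C2 \<epsilon> lam0 \<delta>0 lam \<delta> \<or> case_C3 \<epsilon> lam0 \<delta>0 lam \<delta>"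
  then show "(\<exists>\<zeta>. rotated \<nu>p c lam \<delta> \<zeta>) \<and> lam0 \<le> cmod lam \<and> cmod \<delta> \<le> d"
  proof (elim disjE)
    assume C: "case_C1 \<gamma>1p \<gamma>2p \<nu>p \<epsilon> lam0 lam \<delta>"
    note * = case_C1_rotated[OF C \<epsilon> pos c(1-4)]
    from *(3) have "cmod \<delta> \<le> d" by (simp add: d_def)
    with * show ?thesis by simp
  next
    assume C: "case_C2 \<epsilon> lam0 \<delta>0 lam \<delta>"
    show ?thesis using case_C2_rotated[OF C \<epsilon> pos(2) c(3,5)] C by (auto simp: case_C2_def d_def)
  next
    assume C: "case_C3 \<epsilon> lam0 \<delta>0 lam \<delta>"
    show ?thesis using case_C3_rotated[OF C pos(1) c(1,2)] C by (auto simp: case_C3_def d_def)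
  qed
qed

section \<open>The symbols and their limits\<close>

definition root_symbol :: "real \<Rightarrow> complex \<Rightarrow> complex \<Rightarrow> real \<Rightarrow> complex" where
  "root_symbol \<gamma> \<kappa> lam A = csqrt (\<gamma> / \<kappa> * lam + (of_real A)\<^sup>2)"

text \<open>If the argument were a real \<open>s \<le> 0\<close>, then
  \<open>\<gamma> * lam = (s - A^2) * \<kappa>\<close>. After multiplication by \<zeta> the left
  side has nonnegative real part, and the factor of \<open>s - A^2\<close> on the right is positive;
  this forces \<open>s = A = 0\<close> and then \<open>lam = 0\<close>. The principal root is thus
  continuous there and has positive real part.\<close>

lemma root_symbol_argument_notin_nonpos_Reals:
  fixes A \<gamma> :: real and lam \<kappa> \<zeta> :: complex
  assumes \<zeta>: "Re (\<zeta> * lam) \<ge> 0" "Re (\<zeta> * \<kappa>) > 0" and "\<gamma> > 0" "lam \<noteq> 0 \<or> A \<noteq> 0"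
  shows "\<gamma> / \<kappa> * lam + (of_real A)\<^sup>2 \<notin> \<real>\<^sub>\<le>\<^sub>0"
proof
  assume "\<gamma> / \<kappa> * lam + (of_real A)\<^sup>2 \<in> \<real>\<^sub>\<le>\<^sub>0"
  then obtain s where s: "s \<le> 0" "\<gamma> / \<kappa> * lam + (of_real A)\<^sup>2 = of_real s"
    by (elim nonpos_Reals_cases)
  have \<kappa>: "\<kappa> \<noteq> 0" using \<zeta> by auto
  have "\<gamma> * lam + \<kappa> * (of_real A)\<^sup>2 = \<kappa> * (\<gamma> / \<kappa> * lam + (of_real A)\<^sup>2)"
    using \<kappa> by (simp add: field_simps)
  then have eq: "\<gamma> * lam + \<kappa> * (of_real A)\<^sup>2 = \<kappa> * of_real s" using s by simp
  then have "\<gamma> * lam = of_real (s - A\<^sup>2) * \<kappa>" by (simp add: algebra_simps)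
  then have "of_real \<gamma> * (\<zeta> * lam) = of_real (s - A\<^sup>2) * (\<zeta> * \<kappa>)" by (metis mult.left_commute)
  then have "Re (of_real \<gamma> * (\<zeta> * lam)) = Re (of_real (s - A\<^sup>2) * (\<zeta> * \<kappa>))" by (rule arg_cong)
  then have "\<gamma> * Re (\<zeta> * lam) = (s - A\<^sup>2) * Re (\<zeta> * \<kappa>)" by (simp only: Re_complex_of_real Im_complex_of_real times_complex.sel mult_zero_left diff_zero)
  moreover have "\<gamma> * Re (\<zeta> * lam) \<ge> 0" using assms by simp
  ultimately have "s - A\<^sup>2 \<ge> 0" using \<zeta>(2) by (simp add: zero_le_mult_iff)
  then have "A = 0" "s = 0" using s(1) zero_le_power2[of A] by (auto simp: order_antisym_conv)
  then show False using eq assms by simp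
qed

lemma Re_csqrt_pos: "z \<notin> \<real>\<^sub>\<le>\<^sub>0 \<Longrightarrow> Re (csqrt z) > 0"
proof (rule ccontr)
  assume z: "z \<notin> \<real>\<^sub>\<le>\<^sub>0" and "\<not> Re (csqrt z) > 0"
  then have "Re (csqrt z) = 0" using Re_csqrt[of z] by simp
  then have "csqrt z = \<i> * of_real (Im (csqrt z))" by (simp add: complex_eq_iff)
  then have "z = (\<i> * of_real (Im (csqrt z)))\<^sup>2" by (metis power2_csqrt)
  also have "\<dots> = of_real (- (Im (csqrt z))\<^sup>2)" by (simp add: power_mult_distrib)
  finally have "z \<in> \<real>\<^sub>\<le>\<^sub>0" by (metis nonpos_Reals_of_real_iff neg_le_0_iff_le zero_le_power2)
  with z show False by blast
qed

lemma root_symbol_props: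
  fixes A \<gamma> :: real and lam \<kappa> \<zeta> :: complex
  assumes \<zeta>: "Re (\<zeta> * lam) \<ge> 0" "Re (\<zeta> * \<kappa>) > 0" and "\<gamma> > 0" "lam \<noteq> 0 \<or> A \<noteq> 0"
  shows "Re (root_symbol \<gamma> \<kappa> lam A) > 0" "\<gamma> * lam = \<kappa> * ((root_symbol \<gamma> \<kappa> lam A)\<^sup>2 - (of_real A)\<^sup>2)"
proof -
  show "Re (root_symbol \<gamma> \<kappa> lam A) > 0" unfolding root_symbol_def
    by (rule Re_csqrt_pos[OF root_symbol_argument_notin_nonpos_Reals[OF assms]])
  have "\<kappa> \<noteq> 0" using \<zeta> by auto
  then show "\<gamma> * lam = \<kappa> * ((root_symbol \<gamma> \<kappa> lam A)\<^sup>2 - (of_real A)\<^sup>2)"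
    unfolding root_symbol_def by simp
qed

lemma root_symbol_tendsto:
  fixes A :: "'a \<Rightarrow> real" and lam \<kappa> :: "'a \<Rightarrow> complex" and l k \<zeta> :: complex
  assumes lim: "(lam \<longlongrightarrow> l) F" "(\<kappa> \<longlongrightarrow> k) F" "(A \<longlongrightarrow> a) F"
    and \<zeta>: "Re (\<zeta> * l) \<ge> 0" "Re (\<zeta> * k) > 0" and "\<gamma> > 0" "l \<noteq> 0 \<or> a \<noteq> 0"
  shows "((\<lambda>n. root_symbol \<gamma> (\<kappa> n) (lam n) (A n)) \<longlongrightarrow> root_symbol \<gamma> k l a) F"
proof -
  have "k \<noteq> 0" using \<zeta> by auto
  then have "((\<lambda>n. \<gamma> / \<kappa> n * lam n + (of_real (A n))\<^sup>2) \<longlongrightarrow> \<gamma> / k * l + (of_real a)\<^sup>2) F"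
    by (intro tendsto_intros lim)
  then show ?thesis unfolding root_symbol_def
    by (rule isCont_tendsto_compose[OF continuous_at_csqrt[OF root_symbol_argument_notin_nonpos_Reals[OF \<zeta> assms(6,7)]]])
qed

lemma root_symbol_scale:
  assumes "r > 0"
  shows "root_symbol \<gamma> \<kappa> (lam / (of_real r)\<^sup>2) (A / r) = root_symbol \<gamma> \<kappa> lam A / r"
proof -
  have "root_symbol \<gamma> \<kappa> lam A / r = csqrt (\<gamma> / \<kappa> * (lam / (of_real r)\<^sup>2) + (of_real (A / r))\<^sup>2)"
  proof (rule csqrt_unique[symmetric])
    show "(root_symbol \<gamma> \<kappa> lam A / r)\<^sup>2 = \<gamma> / \<kappa> * (lam / (of_real r)\<^sup>2) + (of_real (A / r))\<^sup>2"
      using assms unfolding root_symbol_def by (simp add: power_divide add_divide_distrib)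
    show "0 < Re (root_symbol \<gamma> \<kappa> lam A / r) \<or> Re (root_symbol \<gamma> \<kappa> lam A / r) = 0 \<and> 0 \<le> Im (root_symbol \<gamma> \<kappa> lam A / r)"
      unfolding root_symbol_def using csqrt_principal[of "\<gamma> / \<kappa> * lam + (of_real A)\<^sup>2"] assms
      by (auto simp: zero_less_divide_iff zero_le_divide_iff)
  qed
  then show ?thesis unfolding root_symbol_def by simp
qed

text \<open>For real \<mu> the constant leaves the principal root, which makes \<open>B_+\<close>
  and \<open>B_-\<close> positive real multiples of each other at zero frequency.\<close>

lemma root_symbol_zero_frequency:
  fixes \<gamma> \<mu> :: real
  assumes "\<gamma> > 0" "\<mu> > 0"
  shows "root_symbol \<gamma> \<mu> lam 0 = sqrt (\<gamma> / \<mu>) * csqrt lam"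
proof -
  define w where "w = csqrt lam"
  have w: "w\<^sup>2 = lam" "0 < Re w \<or> Re w = 0 \<and> 0 \<le> Im w"
    unfolding w_def using csqrt_principal[of lam] by simp_all
  have "csqrt (of_real (\<gamma> / \<mu>) * lam) = sqrt (\<gamma> / \<mu>) * w"
  proof (rule csqrt_unique)
    have "(complex_of_real (sqrt (\<gamma> / \<mu>)))\<^sup>2 = of_real (\<gamma> / \<mu>)"
      using assms by (metis of_real_power real_sqrt_pow2 divide_nonneg_nonneg less_imp_le)
    then show "(sqrt (\<gamma> / \<mu>) * w)\<^sup>2 = of_real (\<gamma> / \<mu>) * lam" using w by (simp add: power_mult_distrib)
    define k where "k = sqrt (\<gamma> / \<mu>)"
    have "k > 0" using assms by (simp add: k_def)
    then have "0 < Re (k * w) \<or> Re (k * w) = 0 \<and> 0 \<le> Im (k * w)" using w(2) by auto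
    then show "0 < Re (sqrt (\<gamma> / \<mu>) * w) \<or> Re (sqrt (\<gamma> / \<mu>) * w) = 0 \<and> 0 \<le> Im (sqrt (\<gamma> / \<mu>) * w)"
      unfolding k_def .
  qed
  then show ?thesis unfolding root_symbol_def w_def by simp
qed

section \<open>The symbols as functions of the parameters and the frequency\<close>

locale two_phase =
  fixes \<mu>p \<mu>m \<nu>p \<gamma>p \<gamma>m :: real
  assumes pos: "\<mu>p > 0" "\<mu>m > 0" "\<nu>p > 0" "\<gamma>p > 0" "\<gamma>m > 0"
begin

definition X_root :: "complex \<Rightarrow> complex \<Rightarrow> real \<Rightarrow> complex" where
  "X_root lam \<delta> A = root_symbol \<gamma>p (\<mu>p + \<nu>p + (\<delta> :: complex)) lam A"
definition Y_root :: "complex \<Rightarrow> real \<Rightarrow> complex" where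
  "Y_root lam A = root_symbol \<gamma>p \<mu>p lam A"
definition Z_root :: "complex \<Rightarrow> real \<Rightarrow> complex" where
  "Z_root lam A = root_symbol \<gamma>m \<mu>m lam A"

text \<open>\<open>(A\<^sub>+ B\<^sub>+ - A\<^sup>2) / \<lambda>\<close>, written so that it makes sense for \<open>\<lambda> = 0\<close>.\<close>

definition gas_denom :: "complex \<Rightarrow> complex \<Rightarrow> real \<Rightarrow> complex" where
  "gas_denom lam \<delta> A =
  \<gamma>p / \<mu>p * X_root lam \<delta> A / (Y_root lam A + of_real A)
  + \<gamma>p / (\<mu>p + \<nu>p + (\<delta> :: complex)) * of_real A / (X_root lam \<delta> A + of_real A)"

text \<open>In \<open>g\<close> and \<open>h\<close> numerator and denominator both contain the
  factor \<lambda>; here it is cancelled. \<open>E\<close>, \<open>e\<close>, \<open>M\<close>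
  remain arguments because their limits depend on the depth as well.\<close>

definition lopatinski_symbol :: "complex \<Rightarrow> complex \<Rightarrow> real \<Rightarrow> complex \<Rightarrow> real \<Rightarrow> complex \<Rightarrow> complex" where
  "lopatinski_symbol lam \<delta> A E e M = symbol_det \<mu>p \<mu>m \<nu>p (\<delta> :: complex) A (X_root lam (\<delta> :: complex) A) (Y_root lam A) (Z_root lam A)
     (\<gamma>p / \<mu>p / gas_denom lam (\<delta> :: complex) A) (\<gamma>p / (\<mu>p + \<nu>p + (\<delta> :: complex)) / gas_denom lam (\<delta> :: complex) A) E e M"

context
  fixes c :: real and lam \<delta> \<zeta> :: complex and A :: real
  assumes rot: "rotated \<nu>p c lam \<delta> \<zeta>" and c: "c > 0" and A: "A \<ge> 0" and nz: "lam \<noteq> 0 \<or> A \<noteq> 0"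
begin

lemma rotated_facts: "Re \<zeta> > 0" "Re (\<zeta> * lam) \<ge> 0" "Re (\<zeta> * (\<nu>p + \<delta>)) > 0"
  "Re (\<zeta> * (\<mu>p + \<nu>p + \<delta>)) > 0" "Re (\<zeta> * \<mu>p) > 0" "Re (\<zeta> * \<mu>m) > 0" "\<mu>p + \<nu>p + \<delta> \<noteq> 0"
proof -
  show r: "Re \<zeta> > 0" "Re (\<zeta> * lam) \<ge> 0" "Re (\<zeta> * (\<nu>p + \<delta>)) > 0"
    using rot c unfolding rotated_def by linarith+
  show m: "Re (\<zeta> * \<mu>p) > 0" "Re (\<zeta> * \<mu>m) > 0" using r pos by simp_all
  have "Re (\<zeta> * (\<mu>p + \<nu>p + \<delta>)) = Re (\<zeta> * \<mu>p) + Re (\<zeta> * (\<nu>p + \<delta>))" by (simp add: algebra_simps)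
  then show 1: "Re (\<zeta> * (\<mu>p + \<nu>p + \<delta>)) > 0" using r m by linarith
  then show "\<mu>p + \<nu>p + \<delta> \<noteq> 0" by (metis less_irrefl mult_zero_right zero_complex.sel(1))
qed

lemma roots:
  "Re (X_root lam \<delta> A) > 0" "\<gamma>p * lam = (\<mu>p + \<nu>p + \<delta>) * ((X_root lam \<delta> A)\<^sup>2 - (of_real A)\<^sup>2)"
  "Re (Y_root lam A) > 0" "\<gamma>p * lam = \<mu>p * ((Y_root lam A)\<^sup>2 - (of_real A)\<^sup>2)"
  "Re (Z_root lam A) > 0" "\<gamma>m * lam = \<mu>m * ((Z_root lam A)\<^sup>2 - (of_real A)\<^sup>2)"
  unfolding X_root_def Y_root_def Z_root_def
  using root_symbol_props[OF rotated_facts(2) _ _ nz] rotated_facts(4-6) pos by blast+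

lemma sums_nonzero:
  "X_root lam \<delta> A + of_real A \<noteq> 0" "Y_root lam A + of_real A \<noteq> 0" "Z_root lam A + of_real A \<noteq> 0"
  "X_root lam \<delta> A + Y_root lam A \<noteq> 0"
  using roots A by (auto simp: complex_eq_iff)

text \<open>\<open>X Y - A^2 = X (Y - A) + A (X - A)\<close>, and the dispersion relations turn
  \<open>Y - A\<close> and \<open>X - A\<close> into multiples of \<open>lam\<close> divided by
  \<open>Y + A\<close> and \<open>X + A\<close>.\<close>

lemma gas_denom_eq: "X_root lam \<delta> A * Y_root lam A - (of_real A)\<^sup>2 = lam * gas_denom lam \<delta> A"
proof -
  define X Y where "X = X_root lam \<delta> A" and "Y = Y_root lam A"
  have s: "X + A \<noteq> 0" "Y + A \<noteq> 0" using sums_nonzero by (simp_all add: X_def Y_def)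
  have "\<gamma>p / (\<mu>p + \<nu>p + \<delta>) * lam = (X - A) * (X + A)"
    using roots(2) rotated_facts(7) unfolding X_def by (simp add: field_simps power2_eq_square)
  then have x: "\<gamma>p / (\<mu>p + \<nu>p + \<delta>) * lam / (X + A) = X - A" using s by simp
  have "\<gamma>p / \<mu>p * lam = (Y - A) * (Y + A)"
    using roots(4) pos unfolding Y_def by (simp add: field_simps power2_eq_square)
  then have y: "\<gamma>p / \<mu>p * lam / (Y + A) = Y - A" using s by simp
  have "lam * gas_denom lam \<delta> A = X * (\<gamma>p / \<mu>p * lam / (Y + A)) + A * (\<gamma>p / (\<mu>p + \<nu>p + \<delta>) * lam / (X + A))"
    unfolding gas_denom_def X_def[symmetric] Y_def[symmetric] by (simp add: algebra_simps)
  also have "\<dots> = X * Y - (of_real A)\<^sup>2" unfolding x y by (simp add: algebra_simps power2_eq_square)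
  finally show ?thesis by (simp add: X_def Y_def)
qed

text \<open>Squaring \<open>X Y = A^2\<close> and inserting the dispersion relations gives
  \<open>\<gamma>p lam + (k + \<mu>p) A^2 = 0\<close> with
  \<open>k = \<mu>p + \<nu>p + \<delta>\<close>. Rotated by \<zeta>, this forces
  \<open>A = 0\<close>, and then \<open>lam = 0\<close>.\<close>

lemma gas_determinant_nonzero:
  assumes "lam \<noteq> 0"
  shows "X_root lam \<delta> A * Y_root lam A \<noteq> (of_real A)\<^sup>2"
proof
  assume *: "X_root lam \<delta> A * Y_root lam A = (of_real A)\<^sup>2"
  define x y a where "x = (X_root lam \<delta> A)\<^sup>2" and "y = (Y_root lam A)\<^sup>2" and "a = (complex_of_real A)\<^sup>2"
  define k where "k = \<mu>p + \<nu>p + \<delta>"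
  have "x * y = (X_root lam \<delta> A * Y_root lam A)\<^sup>2" by (simp add: x_def y_def power_mult_distrib)
  then have xy: "x * y = a * a" unfolding * a_def by (simp add: power2_eq_square)
  have x: "\<gamma>p * lam = k * (x - a)" and y: "\<gamma>p * lam = \<mu>p * (y - a)"
    using roots by (simp_all add: x_def y_def a_def k_def)
  have "(k * x) * (\<mu>p * y) = k * \<mu>p * (a * a)" using xy by (simp add: algebra_simps)
  moreover have "k * x = \<gamma>p * lam + k * a" "\<mu>p * y = \<gamma>p * lam + \<mu>p * a"
    using x y by (simp_all add: algebra_simps)
  ultimately have "(\<gamma>p * lam + k * a) * (\<gamma>p * lam + \<mu>p * a) = k * \<mu>p * (a * a)" by simp
  then have "\<gamma>p * lam * (\<gamma>p * lam + (k + \<mu>p) * a) = 0" by (simp add: algebra_simps)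
  then have eq: "\<gamma>p * lam + (k + \<mu>p) * a = 0" using assms pos by simp
  have "Re (\<zeta> * (\<gamma>p * lam + (k + \<mu>p) * of_real (A\<^sup>2))) = \<gamma>p * Re (\<zeta> * lam) + A\<^sup>2 * (Re (\<zeta> * k) + Re (\<zeta> * \<mu>p))"
    by (simp add: algebra_simps)
  moreover have "Re (\<zeta> * (\<gamma>p * lam + (k + \<mu>p) * of_real (A\<^sup>2))) = 0"
    using eq unfolding a_def of_real_power by (metis mult_zero_right zero_complex.sel(1))
  moreover have "\<gamma>p * Re (\<zeta> * lam) \<ge> 0" using rotated_facts pos by simp
  moreover have "Re (\<zeta> * k) + Re (\<zeta> * \<mu>p) > 0" using rotated_facts(4,5) by (simp add: k_def)
  ultimately have "A\<^sup>2 * (Re (\<zeta> * k) + Re (\<zeta> * \<mu>p)) \<le> 0" by linarith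
  then have "A = 0" using \<open>Re (\<zeta> * k) + Re (\<zeta> * \<mu>p) > 0\<close> by (simp add: mult_le_0_iff)
  then show False using eq assms pos by (simp add: a_def)
qed

lemma gas_denom_nonzero: "gas_denom lam \<delta> A \<noteq> 0"
proof (cases "lam = 0")
  case False
  then show ?thesis using gas_determinant_nonzero gas_denom_eq by auto
next
  case True
  then have A0: "A > 0" using nz A by simp
  have "root_symbol \<gamma> \<kappa> 0 A = A" for \<gamma> \<kappa> using A by (simp add: root_symbol_def)
  then have "gas_denom lam \<delta> A = (\<gamma>p / \<mu>p + \<gamma>p / (\<mu>p + \<nu>p + \<delta>)) / 2"
    unfolding gas_denom_def X_root_def Y_root_def True using A0 by (simp add: add_divide_distrib mult.commute)
  also have "\<gamma>p / \<mu>p + \<gamma>p / (\<mu>p + \<nu>p + \<delta>) = \<gamma>p / (\<mu>p * (\<mu>p + \<nu>p + \<delta>)) * (\<mu>p + (\<mu>p + \<nu>p + \<delta>))"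
    using rotated_facts(7) pos by (simp add: field_simps)
  finally have D: "gas_denom lam \<delta> A = \<gamma>p / (\<mu>p * (\<mu>p + \<nu>p + \<delta>)) * (\<mu>p + (\<mu>p + \<nu>p + \<delta>)) / 2" .
  have "Re (\<zeta> * (\<mu>p + (\<mu>p + \<nu>p + \<delta>))) = Re (\<zeta> * \<mu>p) + Re (\<zeta> * (\<mu>p + \<nu>p + \<delta>))" by (simp add: algebra_simps)
  then have "Re (\<zeta> * (\<mu>p + (\<mu>p + \<nu>p + \<delta>))) > 0" using rotated_facts by linarith
  then have "\<mu>p + (\<mu>p + \<nu>p + \<delta>) \<noteq> 0" by (metis less_irrefl mult_zero_right zero_complex.sel(1))
  then show ?thesis unfolding D using pos rotated_facts(7) by simp
qed

lemma gas_ratios: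
  assumes "lam \<noteq> 0"
  shows "\<gamma>p / \<mu>p / gas_denom lam \<delta> A = ((Y_root lam A)\<^sup>2 - (of_real A)\<^sup>2) / (X_root lam \<delta> A * Y_root lam A - (of_real A)\<^sup>2)"
    "\<gamma>p / (\<mu>p + \<nu>p + \<delta>) / gas_denom lam \<delta> A = ((X_root lam \<delta> A)\<^sup>2 - (of_real A)\<^sup>2) / (X_root lam \<delta> A * Y_root lam A - (of_real A)\<^sup>2)"
proof -
  have x: "(X_root lam \<delta> A)\<^sup>2 - (of_real A)\<^sup>2 = lam * (\<gamma>p / (\<mu>p + \<nu>p + \<delta>))"
    using roots(2) rotated_facts(7) by (simp add: field_simps)
  have y: "(Y_root lam A)\<^sup>2 - (of_real A)\<^sup>2 = lam * (\<gamma>p / \<mu>p)"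
    using roots(4) pos by (simp add: field_simps)
  show "\<gamma>p / \<mu>p / gas_denom lam \<delta> A = ((Y_root lam A)\<^sup>2 - (of_real A)\<^sup>2) / (X_root lam \<delta> A * Y_root lam A - (of_real A)\<^sup>2)"
    "\<gamma>p / (\<mu>p + \<nu>p + \<delta>) / gas_denom lam \<delta> A = ((X_root lam \<delta> A)\<^sup>2 - (of_real A)\<^sup>2) / (X_root lam \<delta> A * Y_root lam A - (of_real A)\<^sup>2)"
    unfolding gas_denom_eq x y using assms by simp_all
qed

lemma lopatinski_symbol_nonzero_energy:
  assumes "A > 0" "lam \<noteq> 0"
    and "E = exp (- Z_root lam A * b) \<and> e = exp (- A * b) \<and> M = (E - e) / (Z_root lam A - A) \<and> b > 0
       \<or> E = 0 \<and> e = 0 \<and> M = 0"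
  shows "lopatinski_symbol lam \<delta> A E e M \<noteq> 0"
  unfolding lopatinski_symbol_def
proof (rule symbol_det_nonzero_energy[unfolded of_real_power, OF pos(1,2,4,5) assms(1,2) rotated_facts(1,2) less_imp_le[OF rotated_facts(3)] roots(2,4,6,1,3,5) _ gas_ratios[OF assms(2)]])
  show "X_root lam \<delta> A * Y_root lam A - (of_real A)\<^sup>2 \<noteq> 0" using gas_determinant_nonzero[OF assms(2)] by simp
  show "E = exp (- Z_root lam A * b) \<and> complex_of_real e = exp (- A * b) \<and> M = (E - e) / (Z_root lam A - A) \<and> b > 0
       \<or> E = 0 \<and> complex_of_real e = 0 \<and> M = 0"
    using assms(3) by auto
qed

lemma lopatinski_symbol_nonzero_elastic:
  assumes "A = 1" "lam = 0"
  shows "lopatinski_symbol lam \<delta> A 0 0 0 \<noteq> 0"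
proof -
  have 1: "root_symbol \<gamma> \<kappa> 0 1 = 1" for \<gamma> \<kappa> by (simp add: root_symbol_def)
  have D: "gas_denom lam \<delta> A = \<gamma>p / \<mu>p / 2 + \<gamma>p / (\<mu>p + \<nu>p + \<delta>) / 2"
    unfolding gas_denom_def X_root_def Y_root_def assms 1 by simp
  have D0: "gas_denom lam \<delta> A \<noteq> 0" by (rule gas_denom_nonzero)
  have k: "\<mu>p + \<nu>p + \<delta> \<noteq> 0" by (rule rotated_facts(7))
  have G: "gas_denom lam \<delta> A * (2 * (\<mu>p + \<nu>p + \<delta>)) = \<gamma>p / \<mu>p * (2 * \<mu>p + \<nu>p + \<delta>)"
    "gas_denom lam \<delta> A * (2 * \<mu>p) = \<gamma>p / (\<mu>p + \<nu>p + \<delta>) * (2 * \<mu>p + \<nu>p + \<delta>)"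
  proof -
    define \<kappa> where "\<kappa> = \<mu>p + \<nu>p + \<delta>"
    have *: "2 * \<mu>p + \<nu>p + \<delta> = \<mu>p + \<kappa>" by (simp add: \<kappa>_def)
    show "gas_denom lam \<delta> A * (2 * (\<mu>p + \<nu>p + \<delta>)) = \<gamma>p / \<mu>p * (2 * \<mu>p + \<nu>p + \<delta>)"
      "gas_denom lam \<delta> A * (2 * \<mu>p) = \<gamma>p / (\<mu>p + \<nu>p + \<delta>) * (2 * \<mu>p + \<nu>p + \<delta>)"
      unfolding D * \<kappa>_def[symmetric] using k[folded \<kappa>_def] pos by (simp_all add: field_simps)
  qed
  have quot: "s / D * t = u" if "D * u = s * t" "D \<noteq> 0" for s t u D :: complex
    using that by (simp add: field_simps)
  have g: "\<gamma>p / \<mu>p / gas_denom lam \<delta> A * (2 * \<mu>p + \<nu>p + \<delta>) = 2 * (\<mu>p + \<nu>p + \<delta>)"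
    "\<gamma>p / (\<mu>p + \<nu>p + \<delta>) / gas_denom lam \<delta> A * (2 * \<mu>p + \<nu>p + \<delta>) = 2 * \<mu>p"
    by (rule quot[OF G(1) D0], rule quot[OF G(2) D0])
  show ?thesis
    using symbol_det_elastic_nonzero[OF pos(1,2) rotated_facts(1) less_imp_le[OF rotated_facts(3)] g]
    unfolding lopatinski_symbol_def X_root_def Y_root_def Z_root_def assms 1 by simp
qed

lemma lopatinski_symbol_nonzero_zero_frequency:
  assumes "A = 0" "Z_root lam A * M = E - e" "cmod E < 1"
  shows "lopatinski_symbol lam \<delta> A E e M \<noteq> 0"
proof -
  define \<kappa> where "\<kappa> = sqrt (\<gamma>p / \<mu>p) / sqrt (\<gamma>m / \<mu>m)"
  have Y: "Y_root lam A = \<kappa> * Z_root lam A"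
    unfolding Y_root_def Z_root_def assms(1) root_symbol_zero_frequency[OF pos(4,1)] root_symbol_zero_frequency[OF pos(5,2)]
    using pos by (simp add: \<kappa>_def)
  have n: "X_root lam \<delta> A \<noteq> 0" "Y_root lam A \<noteq> 0" using roots by auto
  \<comment> \<open>At \<open>A = 0\<close> the second summand of \<open>gas_denom\<close> vanishes
    and the first is \<open>\<gamma>p / \<mu>p * X / Y\<close>.\<close>
  have "X_root lam \<delta> A * (\<gamma>p / \<mu>p / gas_denom lam \<delta> A) = Y_root lam A"
    unfolding gas_denom_def using assms(1) n pos by (simp add: field_simps)
  then show ?thesis unfolding lopatinski_symbol_def
    using symbol_det_zero_frequency_nonzero[OF assms(2) pos(1,2) roots(5) _ _ assms(3), of "X_root lam \<delta> A" _ \<kappa>] pos Y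
    by (simp add: assms(1) \<kappa>_def)
qed

end

end

section \<open>Limits of the rescaled symbols\<close>

lemma norm_exp_diff_le:
  fixes z w :: complex
  assumes "Re z \<le> s" "Re w \<le> s"
  shows "cmod (exp z - exp w) \<le> exp s * cmod (z - w)"
proof (rule field_differentiable_bound)
  show "convex {z. Re z \<le> s}" by (rule convex_halfspace_Re_le)
  show "(exp has_field_derivative exp z) (at z within {z. Re z \<le> s})" for z :: complex
    by (rule DERIV_exp[THEN has_field_derivative_at_within])
qed (use assms in auto)

lemma times_exp_neg_tendsto_0:
  fixes m :: real
  assumes "m > 0"
  shows "((\<lambda>x. x * exp (- (m * x))) \<longlongrightarrow> 0) at_top"
proof -
  have "((\<lambda>x. (1 / m) * ((m * x) ^ 1 / exp (m * x))) \<longlongrightarrow> (1 / m) * 0) at_top"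
    by (intro tendsto_intros filterlim_compose[OF tendsto_power_div_exp_0]
        filterlim_tendsto_pos_mult_at_top[OF tendsto_const assms] filterlim_ident)
  then show ?thesis using assms by (simp add: exp_minus field_simps)
qed

context two_phase
begin

lemma roots_tendsto:
  assumes lim: "(lam \<longlongrightarrow> l) F" "(\<delta> \<longlongrightarrow> d) F" "(A \<longlongrightarrow> a) F"
    and rot: "rotated \<nu>p c l d \<zeta>" "c > 0" "a \<ge> 0" "l \<noteq> 0 \<or> a \<noteq> 0"
  shows "((\<lambda>n. X_root (lam n) (\<delta> n) (A n)) \<longlongrightarrow> X_root l d a) F"
    "((\<lambda>n. Y_root (lam n) (A n)) \<longlongrightarrow> Y_root l a) F"
    "((\<lambda>n. Z_root (lam n) (A n)) \<longlongrightarrow> Z_root l a) F"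
proof -
  note f = rotated_facts[OF rot]
  show "((\<lambda>n. X_root (lam n) (\<delta> n) (A n)) \<longlongrightarrow> X_root l d a) F"
    unfolding X_root_def
    by (rule root_symbol_tendsto[OF lim(1) _ lim(3) f(2,4) pos(4) rot(4)]) (intro tendsto_intros lim)
  show "((\<lambda>n. Y_root (lam n) (A n)) \<longlongrightarrow> Y_root l a) F"
    unfolding Y_root_def by (rule root_symbol_tendsto[OF lim(1) tendsto_const lim(3) f(2,5) pos(4) rot(4)])
  show "((\<lambda>n. Z_root (lam n) (A n)) \<longlongrightarrow> Z_root l a) F"
    unfolding Z_root_def by (rule root_symbol_tendsto[OF lim(1) tendsto_const lim(3) f(2,6) pos(5) rot(4)])
qed

lemma lopatinski_symbol_tendsto:
  assumes lim: "(lam \<longlongrightarrow> l) F" "(\<delta> \<longlongrightarrow> d) F" "(A \<longlongrightarrow> a) F"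
    and EeM: "(E \<longlongrightarrow> E0) F" "(e \<longlongrightarrow> e0) F" "(M \<longlongrightarrow> M0) F"
    and rot: "rotated \<nu>p c l d \<zeta>" "c > 0" "a \<ge> 0" "l \<noteq> 0 \<or> a \<noteq> 0"
  shows "((\<lambda>n. lopatinski_symbol (lam n) (\<delta> n) (A n) (E n) (e n) (M n)) \<longlongrightarrow> lopatinski_symbol l d a E0 e0 M0) F"
proof -
  note r = roots_tendsto[OF lim rot]
  note s = sums_nonzero[OF rot]
  have D: "((\<lambda>n. gas_denom (lam n) (\<delta> n) (A n)) \<longlongrightarrow> gas_denom l d a) F"
    unfolding gas_denom_def using s rotated_facts(7)[OF rot] pos by (intro tendsto_intros r lim) auto
  show ?thesis unfolding lopatinski_symbol_def
    using s rotated_facts(7)[OF rot] pos gas_denom_nonzero[OF rot]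
    by (intro symbol_det_tendsto tendsto_intros r lim EeM D) auto
qed

text \<open>\<open>t\<close> is the reciprocal depth, so that \<open>t0 = 0\<close> encodes infinite
  depth. Convergence of \<open>e\<close> is assumed separately because \<open>exp (- A / t)\<close>
  can accumulate anywhere in [0, 1] when \<open>A\<close> and \<open>t\<close> both tend to 0. The
  bound with \<open>k\<close> excludes \<lambda> = 0 at finite depth.\<close>

lemma lopatinski_symbol_limit_nonzero:
  fixes lam \<delta> \<zeta> :: "nat \<Rightarrow> complex" and A t :: "nat \<Rightarrow> real"
  defines "E \<equiv> \<lambda>n. exp (- Z_root (lam n) (A n) * of_real (inverse (t n)))"
    and "e \<equiv> \<lambda>n. exp (- A n * inverse (t n))"
  defines "M \<equiv> \<lambda>n. (E n - of_real (e n)) / (Z_root (lam n) (A n) - of_real (A n))"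
  assumes lim: "lam \<longlonglongrightarrow> l" "\<delta> \<longlonglongrightarrow> d" "\<zeta> \<longlonglongrightarrow> z" "A \<longlonglongrightarrow> a" "t \<longlonglongrightarrow> t0" "e \<longlonglongrightarrow> e0"
    and rot_n: "\<And>n. rotated \<nu>p c (lam n) (\<delta> n) (\<zeta> n)" and c: "c > 0"
    and A: "\<And>n. A n > 0" and t: "\<And>n. t n > 0" and sphere: "\<And>n. sqrt (cmod (lam n)) + A n = 1"
    and k: "\<And>n. cmod (lam n) \<ge> k * (t n)\<^sup>2" "k > 0"
  shows "\<not> (\<lambda>n. lopatinski_symbol (lam n) (\<delta> n) (A n) (E n) (e n) (M n)) \<longlonglongrightarrow> 0"
proof
  assume zero: "(\<lambda>n. lopatinski_symbol (lam n) (\<delta> n) (A n) (E n) (e n) (M n)) \<longlonglongrightarrow> 0"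
  have rot1: "rotated \<nu>p c l d z"
    unfolding rotated_def
  proof (intro conjI)
    have "(\<lambda>n. cmod (\<zeta> n)) \<longlonglongrightarrow> cmod z" by (intro tendsto_intros lim)
    moreover have "cmod (\<zeta> n) = 1" for n using rot_n by (simp add: rotated_def)
    ultimately show "cmod z = 1" by (simp add: LIMSEQ_const_iff)
    show "c \<le> Re z"
      by (rule LIMSEQ_le_const[OF tendsto_Re[OF lim(3)]]) (use rot_n in \<open>auto simp: rotated_def\<close>)
    have "(\<lambda>n. Re (\<zeta> n * lam n)) \<longlonglongrightarrow> Re (z * l)" by (intro tendsto_intros lim)
    then show "0 \<le> Re (z * l)" by (rule LIMSEQ_le_const) (use rot_n in \<open>auto simp: rotated_def\<close>)
    have "(\<lambda>n. Re (\<zeta> n * (\<nu>p + \<delta> n))) \<longlonglongrightarrow> Re (z * (\<nu>p + d))" by (intro tendsto_intros lim)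
    then show "c \<le> Re (z * (\<nu>p + d))" by (rule LIMSEQ_le_const) (use rot_n in \<open>auto simp: rotated_def\<close>)
  qed
  have a: "a \<ge> 0" by (rule LIMSEQ_le_const[OF lim(4)]) (use A less_imp_le in blast)
  have t0: "t0 \<ge> 0" by (rule LIMSEQ_le_const[OF lim(5)]) (use t less_imp_le in blast)
  have "(\<lambda>n. sqrt (cmod (lam n)) + A n) \<longlonglongrightarrow> sqrt (cmod l) + a" by (intro tendsto_intros lim)
  then have la: "sqrt (cmod l) + a = 1" by (simp add: sphere LIMSEQ_const_iff)
  then have nz: "l \<noteq> 0 \<or> a \<noteq> 0" by auto
  note rot = rot1 c a nz
  have "(\<lambda>n. k * (t n)\<^sup>2) \<longlonglongrightarrow> k * t0\<^sup>2" "(\<lambda>n. cmod (lam n)) \<longlonglongrightarrow> cmod l" by (intro tendsto_intros lim)+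
  then have kl: "k * t0\<^sup>2 \<le> cmod l" by (rule LIMSEQ_le) (use k in blast)
  define Z where "Z = (\<lambda>n. Z_root (lam n) (A n))"
  define Z0 where "Z0 = Z_root l a"
  have Zlim: "Z \<longlonglongrightarrow> Z0" unfolding Z_def Z0_def by (rule roots_tendsto(3)[OF lim(1,2,4) rot])
  have Z0: "Re Z0 > 0" using roots(5)[OF rot] by (simp add: Z0_def)
  have no_limit: False if "E \<longlonglongrightarrow> E0" "e \<longlonglongrightarrow> f0" "M \<longlonglongrightarrow> M0" "lopatinski_symbol l d a E0 f0 M0 \<noteq> 0" for E0 f0 M0
  proof -
    have "(\<lambda>n. lopatinski_symbol (lam n) (\<delta> n) (A n) (E n) (e n) (M n)) \<longlonglongrightarrow> lopatinski_symbol l d a E0 f0 M0"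
      by (rule lopatinski_symbol_tendsto[OF lim(1,2,4) that(1-3) rot])
    then show False using zero that(4) LIMSEQ_unique by blast
  qed
  consider "t0 > 0" | "t0 = 0" using t0 by linarith
  then show False
  proof cases
    case 1
    then have "k * t0\<^sup>2 > 0" using k(2) by simp
    then have l: "l \<noteq> 0" using kl by auto
    have Za: "Z0 - of_real a \<noteq> 0"
    proof
      assume "Z0 - of_real a = 0"
      then have "\<gamma>m * l = 0" using roots(6)[OF rot] by (simp add: Z0_def)
      then show False using l pos by simp
    qed
    have E: "E \<longlonglongrightarrow> exp (- Z0 * of_real (inverse t0))"
      unfolding E_def Z_def[symmetric] using 1 by (intro tendsto_intros Zlim[unfolded Z_def] lim) auto
    have e: "e \<longlonglongrightarrow> exp (- a * inverse t0)"
      unfolding e_def using 1 by (intro tendsto_intros lim) auto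
    have M: "M \<longlonglongrightarrow> (exp (- Z0 * of_real (inverse t0)) - of_real (exp (- a * inverse t0))) / (Z0 - of_real a)"
      unfolding M_def using Za by (intro tendsto_intros E e Zlim[unfolded Z_def] lim) auto
    show False
    proof (cases "a = 0")
      case True
      have "cmod (exp (- Z0 * of_real (inverse t0))) < 1" using 1 Z0 by (simp add: norm_exp_eq_Re)
      moreover have "Z_root l a * ((exp (- Z0 * of_real (inverse t0)) - of_real (exp (- a * inverse t0))) / (Z0 - of_real a))
          = exp (- Z0 * of_real (inverse t0)) - of_real (exp (- a * inverse t0))"
        unfolding Z0_def[symmetric] using Za True by simp
      ultimately show False
        by (intro no_limit[OF E e M] lopatinski_symbol_nonzero_zero_frequency[OF rot True])
    next
      case False
      then have "a > 0" using a by simp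
      then show False using 1
        by (intro no_limit[OF E e M] lopatinski_symbol_nonzero_energy[OF rot _ l, where b = "inverse t0"]) (simp_all flip: Z0_def)
    qed
  next
    case 2
    define x where "x = (\<lambda>n. inverse (t n))"
    have x_pos: "x n > 0" for n using t by (simp add: x_def)
    have x: "filterlim x at_top sequentially"
      unfolding x_def by (rule filterlim_inverse_at_top) (use lim(5) 2 t in auto)
    have decay: "(\<lambda>n. exp (- (f n * x n))) \<longlonglongrightarrow> 0" if "f \<longlonglongrightarrow> f0" "f0 > 0" for f and f0 :: real
      by (rule filterlim_compose[OF exp_at_bot])
         (rule filterlim_compose[OF filterlim_uminus_at_bot_at_top filterlim_tendsto_pos_mult_at_top[OF that x]])
    have E: "E \<longlonglongrightarrow> 0"
    proof (rule tendsto_norm_zero_cancel)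
      have "cmod (exp (- w * of_real y)) = exp (- (Re w * y))" for w y by (simp add: norm_exp_eq_Re)
      then have "cmod (E n) = exp (- (Re (Z n) * x n))" for n unfolding E_def Z_def x_def .
      then show "(\<lambda>n. cmod (E n)) \<longlonglongrightarrow> 0" using decay[OF tendsto_Re[OF Zlim] Z0] by simp
    qed
    show False
    proof (cases "a = 0")
      case True
      \<comment> \<open>The depth is infinite but the frequency tends to 0, so \<open>e0\<close>
        need not vanish; the formula for zero frequency covers every real \<open>e0\<close>.\<close>
      have M: "M \<longlonglongrightarrow> (0 - of_real e0) / (Z0 - of_real a)"
        unfolding M_def using Z0 True by (intro tendsto_intros E lim Zlim[unfolded Z_def]) auto
      have "Z0 \<noteq> 0" using Z0 by auto
      then have "Z_root l a * ((0 - of_real e0) / (Z0 - of_real a)) = 0 - of_real e0"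
        unfolding Z0_def[symmetric] using True by simp
      then show False
        by (intro no_limit[OF E lim(6) M] lopatinski_symbol_nonzero_zero_frequency[OF rot True]) simp_all
    next
      case False
      then have a: "a > 0" using a by simp
      have e: "e \<longlonglongrightarrow> 0" using decay[OF lim(4) a] by (simp add: e_def x_def)
      \<comment> \<open>A rate strictly below both limits, hence eventually below
        \<open>Re (Z n)\<close> and \<open>A n\<close>.\<close>
      define m where "m = min (Re Z0) a / 2"
      have m: "m > 0" "m < Re Z0" "m < a" using a Z0 by (auto simp: m_def min_def)
      have M: "M \<longlonglongrightarrow> 0"
      proof (rule Lim_null_comparison)
        show "(\<lambda>n. x n * exp (- (m * x n))) \<longlonglongrightarrow> 0"
          by (rule filterlim_compose[OF times_exp_neg_tendsto_0[OF m(1)] x])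
        have "\<forall>\<^sub>F n in sequentially. m < Re (Z n)" by (rule order_tendstoD(1)[OF tendsto_Re[OF Zlim] m(2)])
        moreover have "\<forall>\<^sub>F n in sequentially. m < A n" by (rule order_tendstoD(1)[OF lim(4) m(3)])
        ultimately show "\<forall>\<^sub>F n in sequentially. norm (M n) \<le> x n * exp (- (m * x n))"
        proof eventually_elim
          case (elim n)
          have eq: "E n - of_real (e n) = exp (- Z n * of_real (x n)) - exp (- of_real (A n) * of_real (x n))"
            by (simp add: E_def e_def Z_def x_def flip: exp_of_real)
          \<comment> \<open>The mean value estimate produces a factor |Z - A| that cancels the
            denominator of \<open>M\<close>; the bound is therefore uniform even if
            \<open>Z - A\<close> tends to 0, as it does for \<lambda> tending to 0.\<close>
          have "cmod (E n - of_real (e n)) \<le> exp (- (m * x n)) * cmod (- Z n * of_real (x n) - - of_real (A n) * of_real (x n))"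
            unfolding eq by (rule norm_exp_diff_le) (use elim x_pos[of n] in auto)
          also have "- Z n * of_real (x n) - - of_real (A n) * of_real (x n) = - (Z n - of_real (A n)) * of_real (x n)"
            by (simp add: algebra_simps)
          also have "cmod \<dots> = cmod (Z n - of_real (A n)) * x n" using x_pos[of n] by (simp add: norm_mult norm_minus_commute)
          finally have "cmod (E n - of_real (e n)) \<le> x n * exp (- (m * x n)) * cmod (Z n - of_real (A n))"
            by (simp add: mult_ac)
          moreover have "M n = (E n - of_real (e n)) / (Z n - of_real (A n))" by (simp add: M_def Z_def)
          \<comment> \<open>If \<open>Z n = A n\<close>, the quotient \<open>M n\<close> is 0 by the
            convention for division by 0.\<close>
          ultimately show ?case using x_pos[of n]
            by (cases "Z n = of_real (A n)") (simp_all add: norm_divide divide_le_eq)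
        qed
      qed
      \<comment> \<open>By the normalisation, \<open>l = 0\<close> entails \<open>a = 1\<close>, the
        case of static elasticity.\<close>
      have "lopatinski_symbol l d a 0 0 0 \<noteq> 0"
      proof (cases "l = 0")
        case True
        then show ?thesis using la by (intro lopatinski_symbol_nonzero_elastic[OF rot]) auto
      next
        case False
        then show ?thesis by (intro lopatinski_symbol_nonzero_energy[OF rot a]) auto
      qed
      then show False by (rule no_limit[OF E e M])
    qed
  qed
qed

end

section \<open>Scaling and compactness\<close>

context two_phase
begin

lemma lopatinski_symbol_scale:
  assumes rot: "rotated \<nu>p c lam \<delta> \<zeta>" "c > 0" "A \<ge> 0" "lam \<noteq> 0 \<or> A \<noteq> 0" and r: "r > 0"
  shows "lopatinski_symbol lam \<delta> A E e M = (of_real r) ^ 3 * lopatinski_symbol (lam / (of_real r)\<^sup>2) \<delta> (A / r) E e (r * M)"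
proof -
  have X: "X_root lam \<delta> A = r * X_root (lam / (of_real r)\<^sup>2) \<delta> (A / r)"
    and Y: "Y_root lam A = r * Y_root (lam / (of_real r)\<^sup>2) (A / r)"
    and Z: "Z_root lam A = r * Z_root (lam / (of_real r)\<^sup>2) (A / r)"
    unfolding X_root_def Y_root_def Z_root_def root_symbol_scale[OF r] using r by simp_all
  have A: "complex_of_real A = of_real r * of_real (A / r)" using r by simp
  have quot: "(r * u) / (r * v + r * w) = u / (v + w)" for u v w :: complex
    using r by (simp flip: distrib_left)
  have gas: "gas_denom l \<delta> a = \<gamma>p / \<mu>p * (X_root l \<delta> a / (Y_root l a + of_real a))
      + \<gamma>p / (\<mu>p + \<nu>p + \<delta>) * (of_real a / (X_root l \<delta> a + of_real a))" for l a
    by (simp add: gas_denom_def)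
  have D: "gas_denom lam \<delta> A = gas_denom (lam / (of_real r)\<^sup>2) \<delta> (A / r)"
    unfolding gas X Y by (simp only: A quot)
  show ?thesis unfolding lopatinski_symbol_def D X Y Z
    by (subst A, subst symbol_det_homogeneous) (use r in auto)
qed

lemma det_Lopatinski_eq_lopatinski_symbol:
  assumes rot: "rotated \<nu>p c lam \<delta> \<zeta>" "c > 0" "A \<ge> 0" and lam: "lam \<noteq> 0"
  shows "det (Lopatinski_matrix \<mu>p \<mu>m \<nu>p \<gamma>p \<gamma>m b lam \<delta> A) =
    lopatinski_symbol lam \<delta> A (exp (- Z_root lam A * b)) (exp (- A * b))
      ((exp (- Z_root lam A * b) - of_real (exp (- A * b))) / (Z_root lam A - A))"
proof -
  have nz: "lam \<noteq> 0 \<or> A \<noteq> 0" using lam by simp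
  have X: "A_plus \<mu>p \<nu>p \<gamma>p lam \<delta> A = X_root lam \<delta> A" and Y: "B_plus \<mu>p \<gamma>p lam A = Y_root lam A"
    and Z: "B_minus \<mu>m \<gamma>m lam A = Z_root lam A"
    unfolding A_plus_def B_plus_def B_minus_def X_root_def Y_root_def Z_root_def root_symbol_def by simp_all
  have M: "M_minus \<mu>m \<gamma>m b lam A = (exp (- Z_root lam A * b) - of_real (exp (- A * b))) / (Z_root lam A - A)"
    unfolding M_minus_def Z by (simp flip: exp_of_real)
  show ?thesis
    unfolding lopatinski_symbol_def gas_ratios[OF rot nz lam]
    using det_Lopatinski_eq_symbol_det[of \<mu>p \<nu>p \<gamma>p lam \<delta> A \<mu>m \<gamma>m b, unfolded X Y Z M Let_def of_real_power]
      gas_determinant_nonzero[OF rot nz lam] sums_nonzero(4)[OF rot nz] by blast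
qed

lemma det_Lopatinski_lower_bound:
  assumes c: "c > 0" and lam0: "lam0 > 0" and b: "b > 0"
  shows "\<exists>C>0. \<forall>lam \<delta> A \<zeta>. rotated \<nu>p c lam \<delta> \<zeta> \<longrightarrow> lam0 \<le> cmod lam \<longrightarrow> cmod \<delta> \<le> d \<longrightarrow> A > 0 \<longrightarrow>
    C * (sqrt (cmod lam) + A) ^ 3 \<le> cmod (det (Lopatinski_matrix \<mu>p \<mu>m \<nu>p \<gamma>p \<gamma>m b lam \<delta> A))"
proof (rule ccontr)
  assume contra: "\<not> ?thesis"
  let ?det = "\<lambda>lam \<delta> A. cmod (det (Lopatinski_matrix \<mu>p \<mu>m \<nu>p \<gamma>p \<gamma>m b lam \<delta> A))"
  have "\<exists>lam \<delta> A \<zeta>. rotated \<nu>p c lam \<delta> \<zeta> \<and> lam0 \<le> cmod lam \<and> cmod \<delta> \<le> d \<and> A > 0 \<and>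
      ?det lam \<delta> A < inverse (real (Suc n)) * (sqrt (cmod lam) + A) ^ 3" for n
  proof (rule ccontr)
    assume "\<not> ?thesis"
    then have "\<forall>lam \<delta> A \<zeta>. rotated \<nu>p c lam \<delta> \<zeta> \<longrightarrow> lam0 \<le> cmod lam \<longrightarrow> cmod \<delta> \<le> d \<longrightarrow> A > 0 \<longrightarrow>
        inverse (real (Suc n)) * (sqrt (cmod lam) + A) ^ 3 \<le> ?det lam \<delta> A"
      by (meson not_less)
    moreover have "inverse (real (Suc n)) > 0" by simp
    ultimately show False using contra by blast
  qed
  then obtain lam \<delta> A \<zeta> where rot: "\<And>n. rotated \<nu>p c (lam n) (\<delta> n) (\<zeta> n)" and lam: "\<And>n. lam0 \<le> cmod (lam n)"
    and \<delta>: "\<And>n. cmod (\<delta> n) \<le> d" and A: "\<And>n. A n > 0"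
    and small: "\<And>n. ?det (lam n) (\<delta> n) (A n) < inverse (real (Suc n)) * (sqrt (cmod (lam n)) + A n) ^ 3"
    by metis
  define r where "r = (\<lambda>n. sqrt (cmod (lam n)) + A n)"
  define lam' where "lam' = (\<lambda>n. lam n / (of_real (r n))\<^sup>2)"
  define A' where "A' = (\<lambda>n. A n / r n)"
  \<comment> \<open>The reciprocal of the rescaled depth \<open>b * r n\<close>.\<close>
  define t where "t = (\<lambda>n. inverse (b * r n))"
  define e where "e = (\<lambda>n. exp (- A' n * inverse (t n)))"
  define E where "E = (\<lambda>n. exp (- Z_root (lam' n) (A' n) * of_real (inverse (t n))))"
  define M where "M = (\<lambda>n. (E n - of_real (e n)) / (Z_root (lam' n) (A' n) - of_real (A' n)))"
  have lam_nz: "lam n \<noteq> 0" for n using lam[of n] lam0 by auto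
  have r_lower: "r n \<ge> sqrt lam0" for n using lam[of n] A[of n] by (simp add: r_def add_increasing2)
  have sqrt0: "sqrt lam0 > 0" using lam0 by simp
  have r: "r n > 0" for n using r_lower[of n] sqrt0 by linarith
  have t: "t n > 0" for n using r[of n] b by (simp add: t_def)
  have A': "A' n > 0" for n using A r by (simp add: A'_def)
  have norm_lam': "cmod (lam' n) = cmod (lam n) / (r n)\<^sup>2" for n
    using r[of n] by (simp add: lam'_def norm_divide norm_power)
  have sphere: "sqrt (cmod (lam' n)) + A' n = 1" for n
  proof -
    have "sqrt (cmod (lam' n)) = sqrt (cmod (lam n)) / r n"
      unfolding norm_lam' using r[of n] by (simp add: real_sqrt_divide)
    then show ?thesis using r[of n] by (simp add: A'_def r_def flip: add_divide_distrib)
  qed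
  have k: "lam0 * b\<^sup>2 * (t n)\<^sup>2 \<le> cmod (lam' n)" for n
  proof -
    have "lam0 * b\<^sup>2 * (t n)\<^sup>2 = lam0 / (r n)\<^sup>2" using b r[of n] by (simp add: t_def power_mult_distrib power_inverse field_simps)
    also have "\<dots> \<le> cmod (lam' n)" unfolding norm_lam' using lam by (simp add: divide_right_mono)
    finally show ?thesis .
  qed
  have rot': "rotated \<nu>p c (lam' n) (\<delta> n) (\<zeta> n)" for n
  proof -
    have eq: "\<zeta> n * lam' n = of_real (inverse ((r n)\<^sup>2)) * (\<zeta> n * lam n)" by (simp add: lam'_def divide_inverse)
    have "Re (of_real y * w) = y * Re w" for y w by simp
    then have "Re (\<zeta> n * lam' n) = inverse ((r n)\<^sup>2) * Re (\<zeta> n * lam n)" unfolding eq .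
    moreover have "Re (\<zeta> n * lam n) \<ge> 0" using rot[of n] by (simp add: rotated_def)
    ultimately have "Re (\<zeta> n * lam' n) \<ge> 0" by simp
    then show ?thesis using rot[of n] unfolding rotated_def by blast
  qed
  have det_eq: "?det (lam n) (\<delta> n) (A n) = r n ^ 3 * cmod (lopatinski_symbol (lam' n) (\<delta> n) (A' n) (E n) (e n) (M n))" for n
  proof -
    have Z: "Z_root (lam n) (A n) = r n * Z_root (lam' n) (A' n)"
      unfolding Z_root_def lam'_def A'_def root_symbol_scale[OF r] using r[of n] by simp
    have Ar: "A n = r n * A' n" using r[of n] by (simp add: A'_def)
    have E: "exp (- Z_root (lam n) (A n) * b) = E n"
      unfolding Z E_def t_def by (simp add: mult_ac)
    have e: "exp (- A n * b) = e n"
      unfolding e_def t_def by (subst Ar) (simp add: mult_ac)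
    have "r n * ((E n - of_real (e n)) / (Z_root (lam n) (A n) - A n)) = M n"
      unfolding Z M_def using r[of n] by (subst Ar) (simp flip: right_diff_distrib)
    then have "det (Lopatinski_matrix \<mu>p \<mu>m \<nu>p \<gamma>p \<gamma>m b (lam n) (\<delta> n) (A n))
      = (of_real (r n)) ^ 3 * lopatinski_symbol (lam' n) (\<delta> n) (A' n) (E n) (e n) (M n)"
      unfolding det_Lopatinski_eq_lopatinski_symbol[OF rot c less_imp_le[OF A] lam_nz] E e
      by (subst lopatinski_symbol_scale[OF rot c less_imp_le[OF A] _ r[of n]]) (simp_all add: lam_nz lam'_def A'_def)
    then show ?thesis using r[of n] by (simp add: norm_mult norm_power)
  qed
  have lopatinski_symbol_small: "cmod (lopatinski_symbol (lam' n) (\<delta> n) (A' n) (E n) (e n) (M n)) \<le> inverse (real (Suc n))" for n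
  proof -
    have "r n ^ 3 * cmod (lopatinski_symbol (lam' n) (\<delta> n) (A' n) (E n) (e n) (M n)) < r n ^ 3 * inverse (real (Suc n))"
      using small[of n] unfolding det_eq r_def[symmetric] by (simp add: r_def mult.commute)
    moreover have "r n ^ 3 > 0" using r[of n] by simp
    ultimately show ?thesis by (simp only: mult_less_cancel_left_pos less_imp_le)
  qed
  have lopatinski_symbol_lim: "(\<lambda>n. lopatinski_symbol (lam' n) (\<delta> n) (A' n) (E n) (e n) (M n)) \<longlonglongrightarrow> 0"
    by (rule Lim_null_comparison[OF _ LIMSEQ_inverse_real_of_nat]) (use lopatinski_symbol_small in auto)
  \<comment> \<open>The bound on \<open>t\<close> comes from \<open>r \<ge> sqrt lam0\<close>. The
    coordinate \<open>e\<close> is included so that it converges along the subsequence too.\<close>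
  define K where "K = cball (0::complex) 1 \<times> cball (0::complex) d \<times> cball (0::complex) 1
     \<times> {0..1::real} \<times> {0..inverse (b * sqrt lam0)} \<times> {0..1::real}"
  have "compact K" unfolding K_def by (intro compact_Times compact_cball compact_Icc)
  then have K: "seq_compact K" by (rule compact_imp_seq_compact)
  have "(lam' n, \<delta> n, \<zeta> n, A' n, t n, e n) \<in> K" for n
  proof -
    have "sqrt (cmod (lam' n)) \<le> 1" "A' n \<le> 1" using sphere[of n] A'[of n] real_sqrt_ge_zero[OF norm_ge_zero, of "lam' n"] by linarith+
    moreover have "cmod (\<zeta> n) = 1" using rot[of n] by (simp add: rotated_def)
    moreover have "t n \<le> inverse (b * sqrt lam0)"
      unfolding t_def using b sqrt0 r_lower[of n] by (intro le_imp_inverse_le mult_left_mono) auto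
    moreover have "e n \<le> 1" using A'[of n] t[of n] by (simp add: e_def)
    ultimately show ?thesis using \<delta>[of n] A'[of n] t[of n] by (simp add: K_def e_def)
  qed
  then obtain p \<phi> where \<phi>: "strict_mono \<phi>"
    and conv: "((\<lambda>n. (lam' n, \<delta> n, \<zeta> n, A' n, t n, e n)) \<circ> \<phi>) \<longlonglongrightarrow> p"
    using seq_compactE[OF K, of "\<lambda>n. (lam' n, \<delta> n, \<zeta> n, A' n, t n, e n)"] by blast
  note c1 = tendsto_fst[OF conv] and s1 = tendsto_snd[OF conv]
  note c2 = tendsto_fst[OF s1] and s2 = tendsto_snd[OF s1]
  note c3 = tendsto_fst[OF s2] and s3 = tendsto_snd[OF s2]
  note c4 = tendsto_fst[OF s3] and s4 = tendsto_snd[OF s3]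
  note c5 = tendsto_fst[OF s4] and c6 = tendsto_snd[OF s4]
  have "\<not> (\<lambda>n. lopatinski_symbol (lam' (\<phi> n)) (\<delta> (\<phi> n)) (A' (\<phi> n)) (E (\<phi> n)) (e (\<phi> n)) (M (\<phi> n))) \<longlonglongrightarrow> 0"
    unfolding M_def E_def e_def
    by (rule lopatinski_symbol_limit_nonzero[OF c1[simplified o_def fst_conv snd_conv] c2[simplified o_def fst_conv snd_conv]
        c3[simplified o_def fst_conv snd_conv] c4[simplified o_def fst_conv snd_conv]
        c5[simplified o_def fst_conv snd_conv] c6[simplified o_def fst_conv snd_conv, unfolded e_def]
        rot' c A' t sphere k]) (use lam0 b in simp)
  then show False using LIMSEQ_subseq_LIMSEQ[OF lopatinski_symbol_lim \<phi>] by (simp add: o_def)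
qed

end

theorem lemma3p1:
  fixes b \<epsilon> lam0 \<delta>\<^sub>0 \<mu>p \<mu>m \<nu>p \<gamma>1p \<gamma>1m \<gamma>2p :: real
  assumes "b > 0" and "0 < \<epsilon>" and "\<epsilon> < pi / 2" and "lam0 > 0" and "\<delta>\<^sub>0 > 0"
    and "\<mu>p > 0" and "\<mu>m > 0" and "\<nu>p > 0" and "\<gamma>1p > 0" and "\<gamma>1m > 0" and "\<gamma>2p > 0"
  shows "\<exists>C>0. \<forall>N\<ge>2. \<forall>(lam::complex) (\<delta>::complex) (\<xi> :: nat \<Rightarrow> real).
           case_C1 \<gamma>1p \<gamma>2p \<nu>p \<epsilon> lam0 lam \<delta> \<or> case_C2 \<epsilon> lam0 \<delta>\<^sub>0 lam \<delta> \<or> case_C3 \<epsilon> lam0 \<delta>\<^sub>0 lam \<delta> \<longrightarrow>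
           (\<exists>i\<in>{1..N-1}. \<xi> i \<noteq> 0) \<longrightarrow>
           cmod (det (Lopatinski_matrix \<mu>p \<mu>m \<nu>p \<gamma>1p \<gamma>1m b lam \<delta> (L2_set \<xi> {1..N-1})))
             \<ge> C * (sqrt (cmod lam) + L2_set \<xi> {1..N-1}) ^ 3"
proof -
  interpret two_phase \<mu>p \<mu>m \<nu>p \<gamma>1p \<gamma>1m using assms by unfold_locales
  obtain c d where c: "c > 0" and
    adm: "\<And>lam \<delta>. case_C1 \<gamma>1p \<gamma>2p \<nu>p \<epsilon> lam0 lam \<delta> \<or> case_C2 \<epsilon> lam0 \<delta>\<^sub>0 lam \<delta> \<or> case_C3 \<epsilon> lam0 \<delta>\<^sub>0 lam \<delta> \<Longrightarrow>
       (\<exists>\<zeta>. rotated \<nu>p c lam \<delta> \<zeta>) \<and> lam0 \<le> cmod lam \<and> cmod \<delta> \<le> d"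
    using admissible_rotated[OF assms(2-4,8,9,11)] by metis
  obtain C where C: "C > 0" "\<And>lam \<delta> A \<zeta>. rotated \<nu>p c lam \<delta> \<zeta> \<Longrightarrow> lam0 \<le> cmod lam \<Longrightarrow> cmod \<delta> \<le> d \<Longrightarrow> A > 0 \<Longrightarrow>
    C * (sqrt (cmod lam) + A) ^ 3 \<le> cmod (det (Lopatinski_matrix \<mu>p \<mu>m \<nu>p \<gamma>1p \<gamma>1m b lam \<delta> A))"
    using det_Lopatinski_lower_bound[OF c assms(4) assms(1)] by blast
  have L2_pos: "L2_set \<xi> {1..N-1} > 0" if "\<exists>i\<in>{1..N-1}. \<xi> i \<noteq> 0" for \<xi> :: "nat \<Rightarrow> real" and N
    by (metis L2_set_eq_0_iff L2_set_nonneg finite_atLeastAtMost order_less_le that)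
  show ?thesis
  \<comment> \<open>Only the norm of the frequency enters, so \<open>C\<close> does not depend on
    the dimension \<open>N\<close>.\<close>
  proof (intro exI[of _ C] conjI allI impI)
    fix N and lam \<delta> :: complex and \<xi> :: "nat \<Rightarrow> real"
    assume "case_C1 \<gamma>1p \<gamma>2p \<nu>p \<epsilon> lam0 lam \<delta> \<or> case_C2 \<epsilon> lam0 \<delta>\<^sub>0 lam \<delta> \<or> case_C3 \<epsilon> lam0 \<delta>\<^sub>0 lam \<delta>"
    from adm[OF this] obtain \<zeta> where "rotated \<nu>p c lam \<delta> \<zeta>" "lam0 \<le> cmod lam" "cmod \<delta> \<le> d" by blast
    moreover assume "\<exists>i\<in>{1..N-1}. \<xi> i \<noteq> 0"
    ultimately show "C * (sqrt (cmod lam) + L2_set \<xi> {1..N-1}) ^ 3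
        \<le> cmod (det (Lopatinski_matrix \<mu>p \<mu>m \<nu>p \<gamma>1p \<gamma>1m b lam \<delta> (L2_set \<xi> {1..N-1})))"
      using C(2) L2_pos by blast
  qed (rule C(1))
qed

end
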